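(* Let $\psi$ be a symbol, $w$ a weight sequence, $V=(v^{(m)})_{m\in\mathbb{N}}$ a decreasing sequence of strictly positive weights and $p\in\{0\}\cup[1,\infty)$, such that $B_{w,\psi}$ is a well-defined, continuous linear operator on $k_p(V)$. For $m,j\in\mathbb{N}$ put $$u^{(m)}_j:=\frac{v^{(m)}_{\psi^{j}(1)}}{\prod_{l=0}^{j}|w_{\psi^{l}(1)}|}.$$ Then the following hold. (a) The following are equivalent. (i) $B_{w,\psi}$ is transitive on $k_p(V)$. (ii) There is $m\in\mathbb{N}$ such that $\liminf_{j\to\infty}u^{(m)}_j=0$. (b) The following are equivalent. (i) $B_{w,\psi}$ is hypercyclic on $k_p(V)$. (i') $B_{w,\psi}$ is sequentially hypercyclic on $k_p(V)$. (ii) There are $m\in\mathbb{N}$ and a thick set $I\subseteq\mathbb{N}$ such that $\lim_{I\ni j\to\infty}u^{(m)}_j=0$. (c) The following are equivalent. (i) $B_{w,\psi}$ is mixing on $k_p(V)$. (ii) For every infinite set $I\subseteq\mathbb{N}$ there is $m\in\mathbb{N}$ such that $\liminf_{I\ni j\to\infty}u^{(m)}_j=0$. (d) Assume there is $m\in\mathbb{N}$ such that for every $\varepsilon>0$ the set $I_\varepsilon:=\{j\in\mathbb{N}: u^{(m)}_j<\varepsilon\}$ is syndetic. Then $B_{w,\psi}$ is topologically ergodic on $k_p(V)$. (e) The following are equivalent. (i) $B_{w,\psi}$ has a periodic point $x\in k_p(V)$, $x\ne0$. (ii) There is $m\in\mathbb{N}$ such that $(u^{(m)}_j)_{j\in\mathbb{N}}\in\ell_p$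 (respectively, $(u^{(m)}_j)_{j\in\mathbb{N}}\in c_0$ when $p=0$). (iii) $B_{w,\psi}$ is chaotic on $k_p(V)$.
   Context: $\mathbb{N}=\{1,2,\dots\}$, $\mathbb{K}\in\{\mathbb{R},\mathbb{C}\}$, $\omega=\mathbb{K}^{\mathbb{N}}$. A symbol is a bijection $\psi:\mathbb{N}\to\mathbb{N}\setminus\{1\}$ with $\mathbb{N}=\{1\}\cup\bigcup_{n\in\mathbb{N}}\{\psi^n(1)\}$, where $\psi^n$ is the $n$-th iterate and $\psi^0(1):=1$. A weight sequence is $w=(w_j)_{j\in\mathbb{N}}\in\omega$ with $w_j\ne0$ for all $j$. The weighted generalized backward shift is $B_{w,\psi}:\omega\to\omega$, $(x_j)_{j\in\mathbb{N}}\mapsto(w_{\psi(j)}x_{\psi(j)})_{j\in\mathbb{N}}$, and its restriction to an invariant subspace is denoted the same way. Köthe coechelon spaces: a decreasing sequence of strictly positive weights is $V=(v^{(m)})_{m\in\mathbb{N}}$ with $v^{(m)}=(v^{(m)}_j)_{j\in\mathbb{N}}\in(0,\infty)^{\mathbb{N}}$ and $v^{(m)}_j\ge v^{(m+1)}_j$ for all $m,j$. For $1\le p<\infty$, $\ell_p(v^{(m)})=\{x\in\omega: (x_jv^{(m)}_j)_j\in\ell_p\}$ with norm $\|(x_jv_j^{(m)})_j\|_{\ell_p}$, and $c_0(v^{(m)})=\{x\in\omega:(x_jv^{(m)}_j)_j\in c_0\}$ with norm $\sup_j|x_j|v^{(m)}_j$. These are Banach spaces increasing in $m$; $k_p(V)$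 is the locally convex inductive limit $\bigcup_m\ell_p(v^{(m)})$ ($1\le p<\infty$), and $k_0(V)$ is the locally convex inductive limit $\bigcup_m c_0(v^{(m)})$ (finest locally convex topology making all inclusions of the steps continuous). For a continuous linear operator $T$ on a topological vector space $E$ and non-empty open $U,W\subseteq E$, let $N_T(U,W)=\{n\in\mathbb{N}:T^n(U)\cap W\ne\emptyset\}$. $T$ is transitive if all $N_T(U,W)$ are non-empty, mixing if they are all cofinite, topologically ergodic if they are all syndetic. $T$ is (sequentially) hypercyclic if some orbit $\{x,Tx,T^2x,\dots\}$ is (sequentially) dense in $E$; a set is sequentially dense if every element of $E$ is the limit of a sequence in the set. A point $x$ is periodic for $T$ if $T^Nx=x$ for some $N\in\mathbb{N}$; $T$ is chaotic if it is transitive and its periodic points are dense in $E$. $A\subseteq\mathbb{N}$ is syndetic if there is $q\in\mathbb{N}$ with $\{n,\dots,n+q\}\cap A\neq\emptyset$ for all $n\in\mathbb{N}$; $I\subseteq\mathbb{N}$ is thick if for every $q\in\mathbb{N}$ there is $j\in\mathbb{N}$ with $\{j,j+1,\dots,j+q\}\subseteq I$. The notations $\lim_{I\ni j\to\infty}$ and $\liminf_{I\ni j\to\infty}$ mean that $j$ tends to infinity within $I$. *)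

theory Defs
  imports "HOL-Analysis.Analysis"
begin

text \<open>
  Conventions.

  The scalar field is a type \<open>'a :: {real_normed_field, euclidean_space}\<close>.  A finite-dimensional
  commutative real division algebra with multiplicative norm is isometrically isomorphic to the
  reals or to the complex numbers, and both are instances, so quantifying over \<open>'a\<close> is quantifying
  over the two choices of the scalar field.

  Coordinates of a sequence and the weights of a decreasing sequence of weights are indexed by the
  type \<open>nat\<close>: \<open>0 :: nat\<close> plays the role of the first index \<open>1\<close> of \<open>{1, 2, ...}\<close>.  Everything that is
  used as a number (exponents of iterates, lengths of gaps, return times, the lower index of the
  quotients \<open>u\<close>) is not shifted, and sets of such numbers are subsets of \<open>{1..}\<close>.
\<close>

section \<open>Symbols and weighted generalized backward shifts\<close>

definition is_symbol :: "(nat \<Rightarrow> nat) \<Rightarrow> bool" where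
  "is_symbol \<psi> \<longleftrightarrow> bij_betw \<psi> UNIV (UNIV - {0}) \<and> UNIV = {0} \<union> (\<Union>n\<in>{1..}. {(\<psi> ^^ n) 0})"

definition weight_sequence :: "(nat \<Rightarrow> 'a::zero) \<Rightarrow> bool" where
  "weight_sequence w \<longleftrightarrow> (\<forall>j. w j \<noteq> 0)"

definition weighted_shift :: "(nat \<Rightarrow> 'a::times) \<Rightarrow> (nat \<Rightarrow> nat) \<Rightarrow> (nat \<Rightarrow> 'a) \<Rightarrow> (nat \<Rightarrow> 'a)" where
  "weighted_shift w \<psi> x = (\<lambda>j. w (\<psi> j) * x (\<psi> j))"


section \<open>The Banach spaces \<open>\<ell>\<^sub>p(v)\<close> and \<open>c\<^sub>0(v)\<close>\<close>

text \<open>The value \<open>p = 0\<close> stands for \<open>c\<^sub>0\<close>; otherwise \<open>1 \<le> p\<close> is intended.\<close>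

definition lp_space :: "real \<Rightarrow> (nat \<Rightarrow> 'a::real_normed_vector) set" where
  "lp_space p = (if p = 0 then {x. x \<longlonglongrightarrow> 0} else {x. summable (\<lambda>j. norm (x j) powr p)})"

text \<open>Outside of the space the norm is set to 0: \<open>Metric_space\<close> below asks for a distance that is
  nonnegative on the whole type.\<close>

definition lp_norm :: "real \<Rightarrow> (nat \<Rightarrow> 'a::real_normed_vector) \<Rightarrow> real" where
  "lp_norm p x =
     (if x \<notin> lp_space p then 0
      else if p = 0 then (SUP j. norm (x j))
      else (\<Sum>j. norm (x j) powr p) powr (1 / p))"

definition weighted_lp :: "real \<Rightarrow> (nat \<Rightarrow> real) \<Rightarrow> (nat \<Rightarrow> 'a::real_normed_vector) set" where
  "weighted_lp p v = {x. (\<lambda>j. v j *\<^sub>R x j) \<in> lp_space p}"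

definition weighted_lp_dist ::
    "real \<Rightarrow> (nat \<Rightarrow> real) \<Rightarrow> (nat \<Rightarrow> 'a::real_normed_vector) \<Rightarrow> (nat \<Rightarrow> 'a) \<Rightarrow> real" where
  "weighted_lp_dist p v x y = lp_norm p (\<lambda>j. v j *\<^sub>R (x j - y j))"

definition weighted_lp_topology ::
    "real \<Rightarrow> (nat \<Rightarrow> real) \<Rightarrow> (nat \<Rightarrow> 'a::real_normed_vector) topology" where
  "weighted_lp_topology p v = Metric_space.mtopology (weighted_lp p v) (weighted_lp_dist p v)"

lemma powr_convex_nonneg:
  fixes a b s p :: real
  assumes "p \<ge> 1" "a \<ge> 0" "b \<ge> 0" "0 \<le> s" "s \<le> 1"
  shows "(s * a + (1 - s) * b) powr p \<le> s * a powr p + (1 - s) * b powr p"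
proof -
  have scale: "(t * c) powr p \<le> t * c powr p" if "0 \<le> t" "t \<le> 1" "0 \<le> c" for t c :: real
  proof -
    have "t powr p \<le> t"
      using powr_mono'[of 1 p t] that assms by (cases "t = 0") auto
    then show ?thesis
      using that by (simp add: powr_mult mult_right_mono)
  qed
  consider "a = 0" | "b = 0" | "a > 0" "b > 0"
    using assms by linarith
  then show ?thesis
  proof cases
    case 1
    then show ?thesis using scale[of "1 - s" b] assms by simp
  next
    case 2
    then show ?thesis using scale[of s a] assms by simp
  next
    case 3
    then show ?thesis
      using convex_onD[OF powr_convex[OF \<open>p \<ge> 1\<close>], of "1 - s" a b] assms by auto
  qed
qed

lemma lp_space_scale:
  fixes x :: "nat \<Rightarrow> 'a::real_normed_field"
  assumes "x \<in> lp_space p"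
  shows "(\<lambda>j. c * x j) \<in> lp_space p"
  using assms tendsto_mult_right_zero[of x sequentially c]
  by (auto simp: lp_space_def norm_mult powr_mult intro: summable_mult)

lemma lp_space_zero: "(\<lambda>j. 0) \<in> lp_space p"
  by (simp add: lp_space_def)

lemma lp_space_uminus: "(\<lambda>j. - x j) \<in> lp_space p \<longleftrightarrow> x \<in> lp_space p"
  using tendsto_minus_cancel_left[of x 0 sequentially] by (auto simp: lp_space_def)

lemma lp_space_bounded: "x \<in> lp_space 0 \<Longrightarrow> bdd_above (range (\<lambda>j. norm (x j)))"
  unfolding lp_space_def
  by (simp, metis Bseq_eq_bounded bdd_above_norm convergentI convergent_imp_Bseq image_image)

lemma lp_norm_eq_0:
  assumes "x \<in> lp_space p" "p = 0 \<or> 1 \<le> p"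
  shows "lp_norm p x = 0 \<longleftrightarrow> (\<forall>j. x j = 0)"
proof (cases "p = 0")
  case True
  have "norm (x j) \<le> (SUP j. norm (x j))" for j
    using cSUP_upper[OF UNIV_I lp_space_bounded] assms True by blast
  then show ?thesis
    using assms True
    by (auto simp: lp_norm_def)
next
  case False
  then have sm: "summable (\<lambda>j. norm (x j) powr p)"
    using assms by (simp add: lp_space_def)
  show ?thesis
    using assms False suminf_eq_zero_iff[OF sm]
    by (simp add: lp_norm_def)
qed

lemma lp_norm_nonneg: "0 \<le> lp_norm p x"
proof (cases "p = 0 \<and> x \<in> lp_space p")
  case True
  then have "norm (x 0) \<le> (SUP j. norm (x j))"
    using cSUP_upper[OF UNIV_I lp_space_bounded] by blast
  with norm_ge_zero[of "x 0"] have "0 \<le> (SUP j. norm (x j))" by linarith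
  then show ?thesis using True by (simp add: lp_norm_def)
qed (auto simp: lp_norm_def)

lemma lp_norm_powr:
  assumes "x \<in> lp_space p" "1 \<le> p"
  shows "lp_norm p x powr p = (\<Sum>j. norm (x j) powr p)"
proof -
  have "summable (\<lambda>j. norm (x j) powr p)"
    using assms by (simp add: lp_space_def)
  then have "0 \<le> (\<Sum>j. norm (x j) powr p)"
    by (simp add: suminf_nonneg)
  then show ?thesis
    using assms by (simp add: lp_norm_def powr_powr)
qed

text \<open>Minkowski's inequality.\<close>

lemma lp_space_add_norm:
  assumes x: "x \<in> lp_space p" and y: "y \<in> lp_space p" and p: "p = 0 \<or> 1 \<le> p"
  shows "(\<lambda>j. x j + y j) \<in> lp_space p \<and> lp_norm p (\<lambda>j. x j + y j) \<le> lp_norm p x + lp_norm p y"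
proof (cases "p = 0")
  case True
  have mem: "(\<lambda>j. x j + y j) \<in> lp_space p"
    using x y True tendsto_add_zero[of x sequentially y] by (simp add: lp_space_def)
  have "(SUP j. norm (x j + y j)) \<le> (SUP j. norm (x j)) + (SUP j. norm (y j))"
  proof (rule cSUP_least)
    fix j
    have "norm (x j) \<le> (SUP j. norm (x j))" "norm (y j) \<le> (SUP j. norm (y j))"
      using cSUP_upper[OF UNIV_I lp_space_bounded] x y True by blast+
    then show "norm (x j + y j) \<le> (SUP j. norm (x j)) + (SUP j. norm (y j))"
      using norm_triangle_ineq[of "x j" "y j"] by linarith
  qed simp
  then show ?thesis using mem x y True by (simp add: lp_norm_def)
next
  case False
  with p have p1: "1 \<le> p" by simp
  have sx: "summable (\<lambda>j. norm (x j) powr p)" and sy: "summable (\<lambda>j. norm (y j) powr p)"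
    using x y False by (simp_all add: lp_space_def)
  define a b where "a = lp_norm p x" and "b = lp_norm p y"
  have ab: "0 \<le> a" "0 \<le> b" by (simp_all add: a_def b_def lp_norm_nonneg)
  consider "a = 0" | "b = 0" | "a > 0" "b > 0" using ab by linarith
  then show ?thesis
  proof cases
    case 1
    then have "\<forall>j. x j = 0" using lp_norm_eq_0[OF x p] a_def by simp
    then show ?thesis using y lp_norm_nonneg[of p x] by simp
  next
    case 2
    then have "\<forall>j. y j = 0" using lp_norm_eq_0[OF y p] b_def by simp
    then show ?thesis using x lp_norm_nonneg[of p y] by simp
  next
    case 3
    define s where "s = a / (a + b)"
    have s: "0 \<le> s" "s \<le> 1" "1 - s = b / (a + b)"
      using 3 by (simp_all add: s_def field_simps)
    define f where "f = (\<lambda>j. (a + b) powr p *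
      (s * (norm (x j) powr p / a powr p) + (1 - s) * (norm (y j) powr p / b powr p)))"
    have le: "norm (x j + y j) powr p \<le> f j" for j
    proof -
      have "norm (x j + y j) powr p \<le> (norm (x j) + norm (y j)) powr p"
        using p1 by (intro powr_mono2) (auto simp: norm_triangle_ineq)
      also have "norm (x j) + norm (y j)
          = (a + b) * (s * (norm (x j) / a) + (1 - s) * (norm (y j) / b))"
      proof -
        have "(a + b) * s = a" "(a + b) * (1 - s) = b" using 3 s by (simp_all add: s_def)
        then have "(a + b) * (s * (norm (x j) / a) + (1 - s) * (norm (y j) / b))
            = a * (norm (x j) / a) + b * (norm (y j) / b)"
          by (metis (no_types, opaque_lifting) distrib_left mult.assoc)
        then show ?thesis using 3 by simp
      qed
      also have "\<dots> powr p = (a + b) powr p * (s * (norm (x j) / a) + (1 - s) * (norm (y j) / b)) powr p"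
        by (rule powr_mult)
      also have "\<dots> \<le> (a + b) powr p *
          (s * (norm (x j) / a) powr p + (1 - s) * (norm (y j) / b) powr p)"
        using powr_convex_nonneg[OF p1, of "norm (x j) / a" "norm (y j) / b" s] s 3
        by (intro mult_left_mono) auto
      also have "\<dots> = f j"
        using 3 by (simp add: f_def powr_divide)
      finally show ?thesis .
    qed
    have "(\<lambda>j. norm (x j) powr p) sums (a powr p)" "(\<lambda>j. norm (y j) powr p) sums (b powr p)"
      using lp_norm_powr[OF x p1] lp_norm_powr[OF y p1] summable_sums[OF sx] summable_sums[OF sy]
      by (simp_all add: a_def b_def)
    then have "f sums ((a + b) powr p *
        (s * (a powr p / a powr p) + (1 - s) * (b powr p / b powr p)))"
      unfolding f_def by (intro sums_mult sums_add sums_divide)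
    then have f: "f sums ((a + b) powr p)"
      using 3 by simp
    have sm: "summable (\<lambda>j. norm (x j + y j) powr p)"
      by (rule summable_comparison_test'[OF sums_summable[OF f], of 0]) (use le in auto)
    then have mem: "(\<lambda>j. x j + y j) \<in> lp_space p" using False by (simp add: lp_space_def)
    have "(\<Sum>j. norm (x j + y j) powr p) \<le> (a + b) powr p"
      using suminf_le[OF le sm sums_summable[OF f]] sums_unique[OF f] by simp
    then have "(\<Sum>j. norm (x j + y j) powr p) powr (1 / p) \<le> ((a + b) powr p) powr (1 / p)"
      using p1 by (intro powr_mono2) (auto intro!: suminf_nonneg sm)
    also have "\<dots> = a + b" using 3 p1 by (simp add: powr_powr)
    finally show ?thesis using mem False by (simp add: lp_norm_def a_def b_def)
  qed
qed

lemma Metric_space_weighted_lp: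
  fixes v :: "nat \<Rightarrow> real"
  assumes p: "p = 0 \<or> 1 \<le> p" and v: "\<And>j. 0 < v j"
  shows "Metric_space (weighted_lp p v :: (nat \<Rightarrow> 'a::real_normed_vector) set) (weighted_lp_dist p v)"
proof
  have minus: "lp_norm p (\<lambda>j. - x j) = lp_norm p x" for x :: "nat \<Rightarrow> 'a"
    by (simp add: lp_norm_def lp_space_uminus)
  have diff: "(\<lambda>j. v j *\<^sub>R (x j - y j)) \<in> lp_space p"
    if "x \<in> weighted_lp p v" "y \<in> weighted_lp p v" for x y :: "nat \<Rightarrow> 'a"
    using lp_space_add_norm[of "\<lambda>j. v j *\<^sub>R x j" p "\<lambda>j. - (v j *\<^sub>R y j)"] p that
      lp_space_uminus[of "\<lambda>j. v j *\<^sub>R y j" p]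
    by (simp add: weighted_lp_def scaleR_diff_right)
  fix x y z :: "nat \<Rightarrow> 'a"
  show "0 \<le> weighted_lp_dist p v x y"
    by (simp add: weighted_lp_dist_def lp_norm_nonneg)
  show "weighted_lp_dist p v x y = weighted_lp_dist p v y x"
    using minus[of "\<lambda>j. v j *\<^sub>R (x j - y j)"]
    by (simp add: weighted_lp_dist_def flip: scaleR_minus_right)
  assume xy: "x \<in> weighted_lp p v" "y \<in> weighted_lp p v"
  show "weighted_lp_dist p v x y = 0 \<longleftrightarrow> x = y"
    using lp_norm_eq_0[OF diff[OF xy] p] v less_imp_neq[OF v]
    by (auto simp: weighted_lp_dist_def fun_eq_iff)
  assume z: "z \<in> weighted_lp p v"
  have "(\<lambda>j. v j *\<^sub>R (x j - y j) + v j *\<^sub>R (y j - z j)) = (\<lambda>j. v j *\<^sub>R (x j - z j))"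
    by (simp add: fun_eq_iff flip: scaleR_add_right)
  then show "weighted_lp_dist p v x z \<le> weighted_lp_dist p v x y + weighted_lp_dist p v y z"
    using lp_space_add_norm[OF diff[OF xy] diff[OF xy(2) z] p] by (simp add: weighted_lp_dist_def)
qed


section \<open>Locally convex inductive limits of spaces of sequences\<close>

definition seq_subspace :: "(nat \<Rightarrow> 'a::real_normed_field) set \<Rightarrow> bool" where
  "seq_subspace E \<longleftrightarrow> (\<lambda>j. 0) \<in> E \<and> (\<forall>x\<in>E. \<forall>y\<in>E. (\<lambda>j. x j + y j) \<in> E)
     \<and> (\<forall>c. \<forall>x\<in>E. (\<lambda>j. c * x j) \<in> E)"

definition seq_convex :: "(nat \<Rightarrow> 'a::real_normed_field) set \<Rightarrow> bool" where
  "seq_convex C \<longleftrightarrow> (\<forall>x\<in>C. \<forall>y\<in>C. \<forall>t\<in>{0..1::real}. (\<lambda>j. (1 - t) *\<^sub>R x j + t *\<^sub>R y j) \<in> C)"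

text \<open>Hausdorffness is not part of the definition; for coechelon spaces it is automatic, since the
  inclusion into the product space of all sequences is continuous.\<close>

definition locally_convex_topology ::
    "(nat \<Rightarrow> 'a::real_normed_field) set \<Rightarrow> (nat \<Rightarrow> 'a) topology \<Rightarrow> bool" where
  "locally_convex_topology E T \<longleftrightarrow>
     seq_subspace E \<and> topspace T = E
     \<and> continuous_map (prod_topology T T) T (\<lambda>(x, y). \<lambda>j. x j + y j)
     \<and> continuous_map (prod_topology euclidean T) T (\<lambda>(c, x). \<lambda>j. c * x j)
     \<and> (\<forall>U. openin T U \<and> (\<lambda>j. 0) \<in> U \<longrightarrow>
          (\<exists>C W. seq_convex C \<and> openin T W \<and> (\<lambda>j. 0) \<in> W \<and> W \<subseteq> C \<and> C \<subseteq> U))"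

text \<open>\<open>T\<close> is a locally convex topology on the union of the steps that makes the inclusions
  continuous.\<close>

definition admissible_lc_topology ::
    "(nat \<Rightarrow> (nat \<Rightarrow> 'a::real_normed_field) topology) \<Rightarrow> (nat \<Rightarrow> 'a) topology \<Rightarrow> bool" where
  "admissible_lc_topology S T \<longleftrightarrow>
     locally_convex_topology (\<Union>m. topspace (S m)) T \<and> (\<forall>m. continuous_map (S m) T (\<lambda>x. x))"

text \<open>The finest such topology is their supremum: it is generated by the sets that are open in one
  of them.\<close>

definition lc_inductive_limit ::
    "(nat \<Rightarrow> (nat \<Rightarrow> 'a::real_normed_field) topology) \<Rightarrow> (nat \<Rightarrow> 'a) topology" where
  "lc_inductive_limit S = topology_generated_by {U. \<exists>T. admissible_lc_topology S T \<and> openin T U}"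

lemma lc_inductive_limit_finest:
  assumes "admissible_lc_topology S T" "openin T U"
  shows "openin (lc_inductive_limit S) U"
  unfolding lc_inductive_limit_def using assms by (auto intro: topology_generated_by_Basis)

lemma admissible_lc_inductive_limit:
  fixes S :: "nat \<Rightarrow> (nat \<Rightarrow> 'a::real_normed_field) topology"
  assumes E: "seq_subspace (\<Union>m. topspace (S m))"
  shows "admissible_lc_topology S (lc_inductive_limit S)"
proof -
  define E where "E = (\<Union>m. topspace (S m))"
  define \<B> where "\<B> = {U. \<exists>T. admissible_lc_topology S T \<and> openin T U}"
  define L where "L = lc_inductive_limit S"
  have L: "L = topology_generated_by \<B>" by (simp add: L_def lc_inductive_limit_def \<B>_def)
  have ts: "topspace T = E" if "admissible_lc_topology S T" for T
    using that by (simp add: admissible_lc_topology_def locally_convex_topology_def E_def)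
  define I where "I = topology_generated_by {E}"
  have I: "admissible_lc_topology S I"
  proof -
    have into: "continuous_map X I f" if "f ` topspace X \<subseteq> E" for f :: "'b \<Rightarrow> nat \<Rightarrow> 'a" and X
    proof -
      have "f -` E \<inter> topspace X = topspace X" using that by auto
      then show ?thesis unfolding I_def using that by (intro continuous_on_generated_topo) auto
    qed
    have tsI: "topspace I = E" by (simp add: I_def)
    have op: "U = E" if "openin I U" "U \<noteq> {}" for U
    proof -
      have "U = {} \<or> U = E"
        using that(1) unfolding I_def openin_topology_generated_by_iff
        by induction auto
      with that show ?thesis by simp
    qed
    have "continuous_map (prod_topology I I) I (\<lambda>(x, y). \<lambda>j. x j + y j)"
      using E by (intro into) (auto simp: tsI seq_subspace_def E_def[symmetric])
    moreover have "continuous_map (prod_topology euclidean I) I (\<lambda>(c, x). \<lambda>j. c * x j)"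
      using E by (intro into) (auto simp: tsI seq_subspace_def E_def[symmetric])
    moreover have "seq_convex E"
    proof -
      have "(\<lambda>j. (1 - t) *\<^sub>R x j + t *\<^sub>R y j) \<in> E" if "x \<in> E" "y \<in> E"
        for x y :: "nat \<Rightarrow> 'a" and t :: real
      proof -
        have "(\<lambda>j. of_real (1 - t) * x j) \<in> E" "(\<lambda>j. of_real t * y j) \<in> E"
          using E that unfolding E_def[symmetric] seq_subspace_def by blast+
        moreover have "(\<lambda>j. a j + b j) \<in> E" if "a \<in> E" "b \<in> E" for a b
          using E that unfolding E_def[symmetric] seq_subspace_def by blast
        ultimately have "(\<lambda>j. of_real (1 - t) * x j + of_real t * y j) \<in> E"
          by blast
        then show ?thesis by (simp only: scaleR_conv_of_real)
      qed
      then show ?thesis by (simp add: seq_convex_def)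
    qed
    moreover have "continuous_map (S m) I (\<lambda>x. x)" for m
      by (intro into) (auto simp: E_def)
    ultimately show ?thesis
      unfolding admissible_lc_topology_def locally_convex_topology_def
      using E tsI op openin_topspace[of I] by (auto simp: E_def[symmetric])
  qed
  have tsL: "topspace L = E"
  proof
    show "topspace L \<subseteq> E"
      unfolding L using ts openin_subset by (fastforce simp: \<B>_def)
    have "E \<in> \<B>" using I openin_topspace[of I] ts[OF I] by (auto simp: \<B>_def)
    then show "E \<subseteq> topspace L" unfolding L by auto
  qed
  have id: "continuous_map L T (\<lambda>x. x)" if T: "admissible_lc_topology S T" for T
  proof -
    have "openin L {x \<in> topspace L. x \<in> U}" if U: "openin T U" for U
    proof -
      have "{x \<in> topspace L. x \<in> U} = U"
        using openin_subset[OF U] ts[OF T] tsL by blast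
      then show ?thesis
        using lc_inductive_limit_finest[OF T U] by (simp add: L_def)
    qed
    then show ?thesis
      using ts[OF T] tsL by (simp add: continuous_map_def)
  qed
  have into: "continuous_map X L f"
    if "\<And>T. admissible_lc_topology S T \<Longrightarrow> continuous_map X T f" for f :: "'b \<Rightarrow> nat \<Rightarrow> 'a" and X
    unfolding L
  proof (rule continuous_on_generated_topo)
    fix U assume "U \<in> \<B>"
    then obtain T where "admissible_lc_topology S T" "openin T U" by (auto simp: \<B>_def)
    then show "openin X (f -` U \<inter> topspace X)"
      using that[of T] by (simp add: continuous_map_alt)
  next
    have "f ` topspace X \<subseteq> E" using that[OF I] ts[OF I] continuous_map_image_subset_topspace by metis
    then show "f ` topspace X \<subseteq> \<Union> \<B>" using tsL unfolding L by simp
  qed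
  have "continuous_map (prod_topology L L) L (\<lambda>(x, y). \<lambda>j. x j + y j)"
  proof (rule into)
    fix T assume T: "admissible_lc_topology S T"
    have "continuous_map (prod_topology T T) T (\<lambda>(x, y). \<lambda>j. x j + y j)"
      using T by (simp add: admissible_lc_topology_def locally_convex_topology_def)
    from continuous_map_compose[OF _ this]
    have *: "continuous_map (prod_topology L L) T ((\<lambda>(x, y). \<lambda>j. x j + y j) \<circ> (\<lambda>(x, y). (x, y)))"
      if "continuous_map (prod_topology L L) (prod_topology T T) (\<lambda>(x, y). (x, y))"
      using that by blast
    have "continuous_map (prod_topology L L) (prod_topology T T) (\<lambda>(x, y). (x, y))"
      using continuous_map_prod_top[of L L T T "\<lambda>x. x" "\<lambda>x. x"] id[OF T] by simp
    from *[OF this] show "continuous_map (prod_topology L L) T (\<lambda>(x, y). \<lambda>j. x j + y j)"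
      by (simp add: o_def)
  qed
  moreover have "continuous_map (prod_topology euclidean L) L (\<lambda>(c, x). \<lambda>j. c * x j)"
  proof (rule into)
    fix T assume T: "admissible_lc_topology S T"
    have "continuous_map (prod_topology euclidean T) T (\<lambda>(c, x). \<lambda>j. c * x j)"
      using T by (simp add: admissible_lc_topology_def locally_convex_topology_def)
    from continuous_map_compose[OF _ this]
    have *: "continuous_map (prod_topology euclidean L) T ((\<lambda>(c, x). \<lambda>j. c * x j) \<circ> (\<lambda>(c, x). (c, x)))"
      if "continuous_map (prod_topology euclidean L) (prod_topology euclidean T) (\<lambda>(c::'a, x). (c, x))"
      using that by blast
    have "continuous_map (prod_topology euclidean L) (prod_topology euclidean T) (\<lambda>(c::'a, x). (c, x))"
      using continuous_map_prod_top[of euclidean L euclidean T "\<lambda>x::'a. x" "\<lambda>x. x"] id[OF T] by simp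
    from *[OF this] show "continuous_map (prod_topology euclidean L) T (\<lambda>(c, x). \<lambda>j. c * x j)"
      by (simp add: o_def)
  qed
  moreover have "continuous_map (S m) L (\<lambda>x. x)" for m
    by (rule into) (simp add: admissible_lc_topology_def)
  moreover have "\<exists>C W. seq_convex C \<and> openin L W \<and> (\<lambda>j. 0) \<in> W \<and> W \<subseteq> C \<and> C \<subseteq> U"
    if "openin L U" "(\<lambda>j. 0) \<in> U" for U
  proof -
    have "generate_topology_on \<B> U" using that(1) unfolding L by (simp add: openin_topology_generated_by_iff)
    then show ?thesis using that(2)
    proof induction
      case Empty
      then show ?case by simp
    next
      case (Int A B)
      then obtain C W C' W' where
        "seq_convex C" "openin L W" "(\<lambda>j. 0) \<in> W" "W \<subseteq> C" "C \<subseteq> A"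
        "seq_convex C'" "openin L W'" "(\<lambda>j. 0) \<in> W'" "W' \<subseteq> C'" "C' \<subseteq> B" by (metis IntD1 IntD2)
      then show ?case
        by (intro exI[of _ "C \<inter> C'"] exI[of _ "W \<inter> W'"]) (auto simp: seq_convex_def)
    next
      case (UN K)
      then show ?case by (meson Union_iff Union_upper order_trans)
    next
      case (Basis U)
      then obtain T where T: "admissible_lc_topology S T" "openin T U" by (auto simp: \<B>_def)
      then show ?case
        using Basis(2) lc_inductive_limit_finest[OF T(1)]
        unfolding admissible_lc_topology_def locally_convex_topology_def L_def by meson
    qed
  qed
  ultimately show ?thesis
    unfolding admissible_lc_topology_def locally_convex_topology_def L_def[symmetric]
    using E tsL by (simp add: E_def[symmetric])
qed


section \<open>Koethe coechelon spaces\<close>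

definition decreasing_positive_weights :: "(nat \<Rightarrow> nat \<Rightarrow> real) \<Rightarrow> bool" where
  "decreasing_positive_weights V \<longleftrightarrow> (\<forall>m j. 0 < V m j) \<and> (\<forall>m j. V (Suc m) j \<le> V m j)"

definition coechelon_space :: "real \<Rightarrow> (nat \<Rightarrow> nat \<Rightarrow> real) \<Rightarrow> (nat \<Rightarrow> 'a::real_normed_field) set" where
  "coechelon_space p V = (\<Union>m. weighted_lp p (V m))"

definition coechelon_topology ::
    "real \<Rightarrow> (nat \<Rightarrow> nat \<Rightarrow> real) \<Rightarrow> (nat \<Rightarrow> 'a::real_normed_field) topology" where
  "coechelon_topology p V = lc_inductive_limit (\<lambda>m. weighted_lp_topology p (V m))"

lemma topspace_weighted_lp_topology:
  assumes "p = 0 \<or> 1 \<le> p" "\<And>j. 0 < v j"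
  shows "topspace (weighted_lp_topology p v) = weighted_lp p v"
  unfolding weighted_lp_topology_def
  by (rule Metric_space.topspace_mtopology[OF Metric_space_weighted_lp[OF assms]])

lemma weighted_lp_mono:
  assumes "x \<in> weighted_lp p v" "\<And>j. 0 < v' j" "\<And>j. v' j \<le> v j" "p = 0 \<or> 1 \<le> p"
  shows "x \<in> weighted_lp p v'"
proof -
  have le: "norm (v' j *\<^sub>R x j) \<le> norm (v j *\<^sub>R x j)" for j
    using assms(3)[of j] less_imp_le[OF assms(2)[of j]] by (simp add: mult_right_mono)
  show ?thesis
  proof (cases "p = 0")
    case True
    then have "(\<lambda>j. norm (v j *\<^sub>R x j)) \<longlonglongrightarrow> 0"
      using assms(1) tendsto_norm_zero[of "\<lambda>j. v j *\<^sub>R x j"]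
      by (simp add: weighted_lp_def lp_space_def del: norm_scaleR)
    then have "(\<lambda>j. v' j *\<^sub>R x j) \<longlonglongrightarrow> 0"
      by (rule Lim_null_comparison[OF always_eventually, rotated]) (use le in blast)
    then show ?thesis using True by (simp add: weighted_lp_def lp_space_def)
  next
    case False
    then have "summable (\<lambda>j. norm (v j *\<^sub>R x j) powr p)"
      using assms(1) by (simp add: weighted_lp_def lp_space_def)
    then have "summable (\<lambda>j. norm (v' j *\<^sub>R x j) powr p)"
      by (rule summable_comparison_test'[of _ 0])
         (use powr_mono2[OF _ norm_ge_zero le, of p] assms(4) False in auto)
    then show ?thesis using False by (simp add: weighted_lp_def lp_space_def)
  qed
qed

lemma coechelon_topology:
  fixes V :: "nat \<Rightarrow> nat \<Rightarrow> real"
  assumes p: "p = 0 \<or> 1 \<le> p" and V: "decreasing_positive_weights V"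
  defines "T \<equiv> (coechelon_topology p V :: (nat \<Rightarrow> 'a::real_normed_field) topology)"
  shows "locally_convex_topology (coechelon_space p V) T"
    and "continuous_map (weighted_lp_topology p (V m)) T (\<lambda>x. x)"
    and "topspace T = coechelon_space p V"
proof -
  let ?S = "\<lambda>m. weighted_lp_topology p (V m) :: (nat \<Rightarrow> 'a) topology"
  have pos: "0 < V m j" and dec: "V (Suc m) j \<le> V m j" for m j
    using V by (simp_all add: decreasing_positive_weights_def)
  have mono: "V n j \<le> V m j" if "m \<le> n" for m n j
    using lift_Suc_antimono_le[of "\<lambda>m. V m j"] dec that by simp
  have "topspace (?S m) = weighted_lp p (V m)" for m
    by (rule topspace_weighted_lp_topology[OF p pos])
  then have U: "(\<Union>m. topspace (?S m)) = coechelon_space p V"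
    by (simp add: coechelon_space_def)
  have "seq_subspace (coechelon_space p V :: (nat \<Rightarrow> 'a) set)"
    unfolding seq_subspace_def
  proof (intro conjI ballI allI)
    show "(\<lambda>j. 0) \<in> (coechelon_space p V :: (nat \<Rightarrow> 'a) set)"
      by (simp add: coechelon_space_def weighted_lp_def lp_space_zero)
    fix x :: "nat \<Rightarrow> 'a" assume x: "x \<in> coechelon_space p V"
    then obtain m where m: "x \<in> weighted_lp p (V m)" by (auto simp: coechelon_space_def)
    show "(\<lambda>j. c * x j) \<in> coechelon_space p V" for c
      using m lp_space_scale[of "\<lambda>j. V m j *\<^sub>R x j" p c]
      by (auto simp: coechelon_space_def weighted_lp_def)
    fix y :: "nat \<Rightarrow> 'a" assume "y \<in> coechelon_space p V"
    then obtain n where n: "y \<in> weighted_lp p (V n)" by (auto simp: coechelon_space_def)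
    have "x \<in> weighted_lp p (V (max m n))" "y \<in> weighted_lp p (V (max m n))"
      using weighted_lp_mono[OF m pos mono p] weighted_lp_mono[OF n pos mono p] by auto
    then have "(\<lambda>j. x j + y j) \<in> weighted_lp p (V (max m n))"
      using lp_space_add_norm p by (fastforce simp: weighted_lp_def scaleR_add_right)
    then show "(\<lambda>j. x j + y j) \<in> coechelon_space p V" by (auto simp: coechelon_space_def)
  qed
  then have "admissible_lc_topology ?S T"
    unfolding T_def coechelon_topology_def by (intro admissible_lc_inductive_limit) (simp only: U)
  then show lc: "locally_convex_topology (coechelon_space p V) T"
    and "continuous_map (?S m) T (\<lambda>x. x)"
    unfolding admissible_lc_topology_def U by auto
  show "topspace T = coechelon_space p V"
    using lc by (simp add: locally_convex_topology_def)
qed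


section \<open>Dynamics of continuous linear operators\<close>

definition continuous_linear_operator ::
    "(nat \<Rightarrow> 'a::real_normed_field) topology \<Rightarrow> ((nat \<Rightarrow> 'a) \<Rightarrow> (nat \<Rightarrow> 'a)) \<Rightarrow> bool" where
  "continuous_linear_operator T A \<longleftrightarrow>
     (\<forall>x\<in>topspace T. A x \<in> topspace T)
     \<and> (\<forall>x\<in>topspace T. \<forall>y\<in>topspace T. A (\<lambda>j. x j + y j) = (\<lambda>j. A x j + A y j))
     \<and> (\<forall>c. \<forall>x\<in>topspace T. A (\<lambda>j. c * x j) = (\<lambda>j. c * A x j))
     \<and> continuous_map T T A"

definition syndetic :: "nat set \<Rightarrow> bool" where
  "syndetic A \<longleftrightarrow> (\<exists>q\<ge>1. \<forall>n\<ge>1. {n..n + q} \<inter> A \<noteq> {})"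

definition thick :: "nat set \<Rightarrow> bool" where
  "thick I \<longleftrightarrow> (\<forall>q\<ge>1. \<exists>j\<ge>1. {j..j + q} \<subseteq> I)"

definition return_set :: "('b \<Rightarrow> 'b) \<Rightarrow> 'b set \<Rightarrow> 'b set \<Rightarrow> nat set" where
  "return_set A U W = {n. 1 \<le> n \<and> (A ^^ n) ` U \<inter> W \<noteq> {}}"

definition transitive :: "'b topology \<Rightarrow> ('b \<Rightarrow> 'b) \<Rightarrow> bool" where
  "transitive T A \<longleftrightarrow> (\<forall>U W. openin T U \<and> U \<noteq> {} \<and> openin T W \<and> W \<noteq> {} \<longrightarrow>
     return_set A U W \<noteq> {})"

definition mixing :: "'b topology \<Rightarrow> ('b \<Rightarrow> 'b) \<Rightarrow> bool" where
  "mixing T A \<longleftrightarrow> (\<forall>U W. openin T U \<and> U \<noteq> {} \<and> openin T W \<and> W \<noteq> {} \<longrightarrow>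
     finite ({1..} - return_set A U W))"

definition topologically_ergodic :: "'b topology \<Rightarrow> ('b \<Rightarrow> 'b) \<Rightarrow> bool" where
  "topologically_ergodic T A \<longleftrightarrow> (\<forall>U W. openin T U \<and> U \<noteq> {} \<and> openin T W \<and> W \<noteq> {} \<longrightarrow>
     syndetic (return_set A U W))"

definition dense_in :: "'b topology \<Rightarrow> 'b set \<Rightarrow> bool" where
  "dense_in T D \<longleftrightarrow> T closure_of D = topspace T"

definition sequentially_dense_in :: "'b topology \<Rightarrow> 'b set \<Rightarrow> bool" where
  "sequentially_dense_in T D \<longleftrightarrow>
     (\<forall>y\<in>topspace T. \<exists>s::nat \<Rightarrow> 'b. range s \<subseteq> D \<and> limitin T s y sequentially)"

definition orbit_of :: "('b \<Rightarrow> 'b) \<Rightarrow> 'b \<Rightarrow> 'b set" where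
  "orbit_of A x = range (\<lambda>n. (A ^^ n) x)"

definition hypercyclic :: "'b topology \<Rightarrow> ('b \<Rightarrow> 'b) \<Rightarrow> bool" where
  "hypercyclic T A \<longleftrightarrow> (\<exists>x\<in>topspace T. dense_in T (orbit_of A x))"

definition sequentially_hypercyclic :: "'b topology \<Rightarrow> ('b \<Rightarrow> 'b) \<Rightarrow> bool" where
  "sequentially_hypercyclic T A \<longleftrightarrow> (\<exists>x\<in>topspace T. sequentially_dense_in T (orbit_of A x))"

definition periodic_points :: "'b topology \<Rightarrow> ('b \<Rightarrow> 'b) \<Rightarrow> 'b set" where
  "periodic_points T A = {x \<in> topspace T. \<exists>N\<ge>1. (A ^^ N) x = x}"

definition chaotic :: "'b topology \<Rightarrow> ('b \<Rightarrow> 'b) \<Rightarrow> bool" where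
  "chaotic T A \<longleftrightarrow> transitive T A \<and> dense_in T (periodic_points T A)"


section \<open>The characterizing quantity\<close>

definition u_quot ::
    "(nat \<Rightarrow> 'a::real_normed_field) \<Rightarrow> (nat \<Rightarrow> nat) \<Rightarrow> (nat \<Rightarrow> nat \<Rightarrow> real) \<Rightarrow> nat \<Rightarrow> nat \<Rightarrow> real" where
  "u_quot w \<psi> V m j = V m ((\<psi> ^^ j) 0) / (\<Prod>l=0..j. norm (w ((\<psi> ^^ l) 0)))"

text \<open>\<open>j\<close> tends to infinity within \<open>I\<close>.\<close>

definition at_top_in :: "nat set \<Rightarrow> nat filter" where
  "at_top_in I = inf at_top (principal I)"

end

theory Submission
  imports Defs
begin

text \<open>
  Write \<open>o\<^sub>j = \<psi>\<^sup>j(0)\<close>; the symbol condition says that \<open>j \<mapsto> o\<^sub>j\<close> is a bijection of the index set.  In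
  the rescaled coordinates \<open>c\<^sub>j(x) = w(o\<^sub>0) \<dots> w(o\<^sub>j) x(o\<^sub>j)\<close> the operator becomes the unweighted
  backward shift, \<open>c\<^sub>j(B x) = c\<^sub>j\<^sub>+\<^sub>1(x)\<close>, and the \<open>m\<close>-th step becomes the weighted sequence space with
  weight \<open>(u\<^sup>m\<^sub>j)\<^sub>j\<close>.  In particular the vector \<open>f\<^sub>j\<close> with the single coordinate \<open>c\<^sub>j = 1\<close> has norm
  \<open>u\<^sup>m\<^sub>j\<close> in the \<open>m\<close>-th step, and \<open>B\<close> maps \<open>f\<^sub>j\<^sub>+\<^sub>1\<close> to \<open>f\<^sub>j\<close>.

  Necessity in the statements on transitivity and mixing.  Suppose that for every \<open>m\<close> the numbers
  \<open>u\<^sup>m\<^sub>j\<close>, \<open>j \<in> I\<close>, are bounded below by a positive constant.  Then \<open>sup\<^sub>j\<^sub>\<in>\<^sub>I |c\<^sub>j|\<close> is a seminorm that is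
  bounded by a multiple of the norm on each step, hence continuous on the inductive limit, and \<open>B\<^sup>j\<close>
  with \<open>j \<in> I\<close> maps no point of its unit ball into \<open>{|c\<^sub>0| > 1}\<close> (lemma \<open>no_return\<close>).

  Sufficiency (lemma \<open>return_times\<close>).  Vectors with finitely many nonzero coordinates are dense.
  Given such \<open>x \<in> U\<close> and \<open>y \<in> W\<close> with coordinates below \<open>N\<close>, put
  \<open>P z = x + \<Sum>\<^sub>s\<^sub>\<le>\<^sub>N c\<^sub>s(y) B\<^sup>N\<^sup>-\<^sup>s z\<close>.  This map is continuous with \<open>P 0 = x\<close>, so \<open>P f\<^sub>j \<in> U\<close> as soon as
  \<open>u\<^sup>m\<^sub>j\<close> is small, while \<open>B\<^sup>j\<^sup>-\<^sup>N (P f\<^sub>j) = y\<close> when \<open>j \<ge> 2 N\<close>.  Hence smallness of a single \<open>u\<^sup>m\<^sub>j\<close> already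
  produces the return time \<open>j - N\<close>, which settles transitivity, mixing and topological ergodicity.

  Hypercyclicity.  If \<open>x\<close> in the \<open>m\<close>-th step has a dense orbit, then arbitrarily long blocks of its
  coordinates are arbitrarily large; since \<open>u\<^sup>m\<^sub>j |c\<^sub>j(x)|\<close> is bounded, \<open>u\<^sup>m\<close> tends to \<open>0\<close> along the thick
  union of these blocks.  Conversely, if \<open>u\<^sup>m\<close> tends to \<open>0\<close> along a thick set, then a sequentially
  hypercyclic vector is obtained by writing the members of a countable dense set of finite vectors
  one after another into blocks of coordinates that lie far out and far apart, where \<open>u\<^sup>m\<close> is small
  also on a long stretch before each block; what the later blocks contribute to the iterates tends
  to \<open>0\<close> in the \<open>m\<close>-th step.

  Periodic points.  The coordinates of a nonzero periodic point are a periodic sequence, and adding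
  the moduli of finitely many iterates gives a sequence that is bounded below, so \<open>u\<^sup>m\<close> itself lies in
  \<open>\<ell>\<^sub>p\<close> (or \<open>c\<^sub>0\<close>) for some \<open>m\<close>.  If it does, then every finite vector is the limit of its
  periodizations with growing periods, and \<open>u\<^sup>m\<close> tends to \<open>0\<close>, so that \<open>B\<close> is chaotic.
\<close>


section \<open>The spaces \<open>\<ell>\<^sub>p\<close> and \<open>c\<^sub>0\<close>\<close>

lemma lp_cong_norm:
  assumes "\<And>j. norm (x j) = norm (y j)"
  shows "x \<in> lp_space p \<longleftrightarrow> y \<in> lp_space p" "lp_norm p x = lp_norm p y"
proof -
  have "x \<longlonglongrightarrow> 0 \<longleftrightarrow> y \<longlonglongrightarrow> 0"
    using tendsto_norm_zero_iff[of x sequentially] tendsto_norm_zero_iff[of y sequentially] assms by simp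
  then show iff: "x \<in> lp_space p \<longleftrightarrow> y \<in> lp_space p" by (simp add: lp_space_def assms)
  show "lp_norm p x = lp_norm p y" by (simp add: lp_norm_def iff assms)
qed

lemma lp_space_dominated:
  assumes "y \<in> lp_space p" "\<And>j. norm (x j) \<le> norm (y j)" "p = 0 \<or> 1 \<le> p"
  shows "x \<in> lp_space p" "lp_norm p x \<le> lp_norm p y"
proof -
  have "x \<in> lp_space p \<and> lp_norm p x \<le> lp_norm p y"
  proof (cases "p = 0")
    case True
    have "(\<lambda>j. norm (y j)) \<longlonglongrightarrow> 0"
      using assms(1) True by (simp add: lp_space_def tendsto_norm_zero)
    then have "x \<longlonglongrightarrow> 0"
      by (rule Lim_null_comparison[OF always_eventually, rotated]) (use assms(2) in blast)
    then have x: "x \<in> lp_space p" using True by (simp add: lp_space_def)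
    have "(SUP j. norm (x j)) \<le> (SUP j. norm (y j))"
      by (rule cSUP_mono) (use assms(1,2) lp_space_bounded True in auto)
    then show ?thesis using x assms(1) True by (simp add: lp_norm_def)
  next
    case False
    have le: "norm (x j) powr p \<le> norm (y j) powr p" for j
      using assms(2,3) False by (intro powr_mono2) auto
    have y: "summable (\<lambda>j. norm (y j) powr p)" using assms(1) False by (simp add: lp_space_def)
    then have x: "summable (\<lambda>j. norm (x j) powr p)"
      by (rule summable_comparison_test'[of _ 0]) (use le in auto)
    have "(\<Sum>j. norm (x j) powr p) powr (1 / p) \<le> (\<Sum>j. norm (y j) powr p) powr (1 / p)"
      using assms(3) False by (intro powr_mono2 suminf_le[OF le x y] suminf_nonneg[OF x]) auto
    then show ?thesis using x assms(1) False by (simp add: lp_norm_def lp_space_def)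
  qed
  then show "x \<in> lp_space p" "lp_norm p x \<le> lp_norm p y" by auto
qed

lemma norm_le_lp_norm:
  assumes "x \<in> lp_space p" "p = 0 \<or> 1 \<le> p"
  shows "norm (x j) \<le> lp_norm p x"
proof (cases "p = 0")
  case True
  then show ?thesis
    using cSUP_upper[OF UNIV_I lp_space_bounded] assms by (simp add: lp_norm_def)
next
  case False
  then have "summable (\<lambda>j. norm (x j) powr p)" using assms by (simp add: lp_space_def)
  then have "norm (x j) powr p \<le> (\<Sum>j. norm (x j) powr p)"
    using sum_le_suminf[of "\<lambda>j. norm (x j) powr p" "{j}"] by simp
  then have "norm (x j) powr p \<le> lp_norm p x powr p"
    using lp_norm_powr[of x p] assms False by simp
  then show ?thesis
    using False assms(2) powr_less_mono2[of p "lp_norm p x" "norm (x j)"] lp_norm_nonneg[of p x]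
    by (cases "norm (x j) \<le> lp_norm p x") auto
qed

lemma lp_tail:
  assumes x: "x \<in> lp_space p" and p: "p = 0 \<or> 1 \<le> p"
  shows "(\<lambda>j. if n \<le> j then x j else 0) \<in> lp_space p"
    and "(\<lambda>n. lp_norm p (\<lambda>j. if n \<le> j then x j else 0)) \<longlonglongrightarrow> 0"
proof -
  show mem: "(\<lambda>j. if n \<le> j then x j else 0) \<in> lp_space p" for n
    by (rule lp_space_dominated(1)[OF x _ p]) auto
  show "(\<lambda>n. lp_norm p (\<lambda>j. if n \<le> j then x j else 0)) \<longlonglongrightarrow> 0"
  proof (cases "p = 0")
    case True
    show ?thesis
    proof (rule LIMSEQ_I)
      fix r :: real assume "0 < r"
      then obtain M where M: "\<And>j. M \<le> j \<Longrightarrow> norm (x j) < r / 2"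
        using x True LIMSEQ_D[of x 0 "r / 2"] by (auto simp: lp_space_def)
      have "lp_norm p (\<lambda>j. if n \<le> j then x j else 0) \<le> r / 2" if "M \<le> n" for n
      proof -
        have "norm (if n \<le> j then x j else 0) \<le> r / 2" for j
          using M[of j] that \<open>0 < r\<close> by (cases "n \<le> j") auto
        then have "(SUP j. norm (if n \<le> j then x j else 0)) \<le> r / 2"
          by (intro cSUP_least) auto
        then show ?thesis using mem[of n] True by (simp add: lp_norm_def)
      qed
      then have "norm (lp_norm p (\<lambda>j. if n \<le> j then x j else 0) - 0) < r" if "M \<le> n" for n
        using \<open>0 < r\<close> that lp_norm_nonneg[of p "\<lambda>j. if n \<le> j then x j else 0"] by fastforce
      then show "\<exists>M. \<forall>n\<ge>M. norm (lp_norm p (\<lambda>j. if n \<le> j then x j else 0) - 0) < r"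
        by blast
    qed
  next
    case False
    then have p1: "1 \<le> p" using p by simp
    have sm: "summable (\<lambda>j. norm (x j) powr p)" using x False by (simp add: lp_space_def)
    have eq: "(\<Sum>j. norm (if n \<le> j then x j else 0) powr p) = (\<Sum>j. norm (x (j + n)) powr p)" for n
    proof -
      have s: "summable (\<lambda>j. norm (if n \<le> j then x j else 0) powr p)"
        using mem[of n] False by (simp add: lp_space_def)
      show ?thesis using suminf_split_initial_segment[OF s, of n] by simp
    qed
    have "(\<lambda>n. (\<Sum>j. norm (x (j + n)) powr p) powr (1 / p)) \<longlonglongrightarrow> 0 powr (1 / p)"
    proof (rule tendsto_powr2)
      show "\<forall>\<^sub>F n in sequentially. 0 \<le> (\<Sum>j. norm (x (j + n)) powr p)"
        by (intro always_eventually allI suminf_nonneg summable_ignore_initial_segment[OF sm]) simp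
    qed (use p1 suminf_exist_split2[OF sm] in auto)
    then show ?thesis using mem False by (simp add: lp_norm_def eq)
  qed
qed

lemma lp_reindex_bij:
  assumes "bij g"
  shows "(\<lambda>j. x (g j)) \<in> lp_space p \<longleftrightarrow> x \<in> lp_space p"
    and "lp_norm p (\<lambda>j. x (g j)) = lp_norm p x"
proof -
  have 1: "(\<lambda>j. x (g j)) \<in> lp_space p" if "bij g" "x \<in> lp_space p" for g x
  proof (cases "p = 0")
    case True
    have "filterlim g at_top at_top"
      unfolding filterlim_at_top
    proof
      fix Z
      have "finite (g -` {..<Z})" using that(1) by (intro finite_vimageI) (auto simp: bij_is_inj)
      then show "\<forall>\<^sub>F j in sequentially. Z \<le> g j"
        unfolding cofinite_eq_sequentially[symmetric] eventually_cofinite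
        by (rule rev_finite_subset) auto
    qed
    then show ?thesis using that True
      by (auto simp: lp_space_def intro: filterlim_compose[of x])
  next
    case False
    then show ?thesis using that summable_reindex[of "\<lambda>j. norm (x j) powr p" g]
      by (auto simp: lp_space_def bij_is_inj o_def)
  qed
  show iff: "(\<lambda>j. x (g j)) \<in> lp_space p \<longleftrightarrow> x \<in> lp_space p"
    using 1[OF assms, of x] 1[OF bij_imp_bij_inv[OF assms], of "\<lambda>j. x (g j)"] assms
    by (auto simp: surj_f_inv_f[OF bij_is_surj])
  have "(SUP j. norm (x (g j))) = (SUP j. norm (x j))"
    using bij_is_surj[OF assms] image_image[of "\<lambda>j. norm (x j)" g UNIV] by simp
  moreover have "(\<Sum>j. norm (x (g j)) powr p) = (\<Sum>j. norm (x j) powr p)" 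
    if "x \<in> lp_space p" "p \<noteq> 0"
    using suminf_reindex[of "\<lambda>j. norm (x j) powr p" g] that assms
    by (auto simp: lp_space_def bij_is_inj bij_is_surj o_def)
  ultimately show "lp_norm p (\<lambda>j. x (g j)) = lp_norm p x"
    by (simp add: lp_norm_def iff)
qed

text \<open>The norm of \<open>\<ell>\<^sub>1\<close> dominates the norms of all \<open>\<ell>\<^sub>p\<close> and of \<open>c\<^sub>0\<close>, so estimates of finite and of
  blockwise defined vectors need not distinguish the values of \<open>p\<close>.\<close>

lemma lp_norm_le_l1:
  assumes s: "\<And>n. (\<Sum>j<n. norm (x j)) \<le> s" and p: "p = 0 \<or> 1 \<le> p"
  shows "x \<in> lp_space p" "lp_norm p x \<le> s"
proof -
  have sm: "summable (\<lambda>j. norm (x j))"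
    by (rule summableI_nonneg_bounded[where x = s]) (use s in auto)
  have tot: "(\<Sum>j. norm (x j)) \<le> s" by (rule suminf_le_const[OF sm s])
  have s0: "0 \<le> s" using s[of 0] by simp
  have le: "norm (x j) \<le> s" for j
    using sum_le_suminf[OF sm, of "{j}"] tot by simp
  have "x \<in> lp_space p \<and> lp_norm p x \<le> s"
  proof (cases "p = 0")
    case True
    have "x \<longlonglongrightarrow> 0" using summable_LIMSEQ_zero[OF sm] tendsto_norm_zero_iff by blast
    then show ?thesis using True le by (auto simp: lp_space_def lp_norm_def intro: cSUP_least)
  next
    case False
    then have p1: "1 \<le> p" using p by simp
    have pw: "norm (x j) powr p \<le> s powr (p - 1) * norm (x j)" for j
    proof (cases "x j = 0")
      case False
      then have "norm (x j) powr p = norm (x j) powr (p - 1) * norm (x j)"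
        by (simp add: powr_diff)
      also have "\<dots> \<le> s powr (p - 1) * norm (x j)"
        using p1 le[of j] by (intro mult_right_mono powr_mono2) auto
      finally show ?thesis .
    qed (use p1 in simp)
    have sm': "summable (\<lambda>j. s powr (p - 1) * norm (x j))" by (rule summable_mult[OF sm])
    have smp: "summable (\<lambda>j. norm (x j) powr p)"
      by (rule summable_comparison_test'[OF sm', of 0]) (use pw in auto)
    have "(\<Sum>j. norm (x j) powr p) \<le> s powr (p - 1) * (\<Sum>j. norm (x j))"
      using suminf_le[OF pw smp sm'] suminf_mult[OF sm] by simp
    also have "\<dots> \<le> s powr (p - 1) * s" using tot by (intro mult_left_mono) auto
    also have "\<dots> = s powr p" using s0 p1 by (cases "s = 0") (auto simp: powr_diff)
    finally have "(\<Sum>j. norm (x j) powr p) powr (1 / p) \<le> (s powr p) powr (1 / p)"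
      using p1 by (intro powr_mono2 suminf_nonneg[OF smp]) auto
    then show ?thesis using smp False s0 p1 by (simp add: lp_space_def lp_norm_def powr_powr)
  qed
  then show "x \<in> lp_space p" "lp_norm p x \<le> s" by auto
qed

lemma lp_space_Suc: "(\<lambda>j. x (Suc j)) \<in> lp_space p \<longleftrightarrow> x \<in> lp_space p"
  by (simp add: lp_space_def filterlim_sequentially_Suc summable_Suc_iff[of "\<lambda>j. norm (x j) powr p"])


section \<open>Limits along sets of indices\<close>

text \<open>For finite \<open>I\<close> both sides fail: the filter is trivial, and the lower limit is infinite.\<close>

lemma Liminf_at_top_in_eq_0_iff:
  assumes "\<And>j. 0 < f j"
  shows "Liminf (at_top_in I) (\<lambda>j. ereal (f j)) = 0 \<longleftrightarrow> (\<forall>\<epsilon>>0. \<forall>n. \<exists>j\<in>I. n \<le> j \<and> f j < \<epsilon>)"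
proof -
  have ev: "eventually P (at_top_in I) \<longleftrightarrow> (\<exists>n. \<forall>j\<in>I. n \<le> j \<longrightarrow> P j)" for P
    by (auto simp: at_top_in_def eventually_inf_principal eventually_at_top_linorder)
  have ge: "0 \<le> Liminf (at_top_in I) (\<lambda>j. ereal (f j))"
    by (rule Liminf_bounded) (simp add: assms less_imp_le)
  show ?thesis
  proof
    assume L: "Liminf (at_top_in I) (\<lambda>j. ereal (f j)) = 0"
    show "\<forall>\<epsilon>>0. \<forall>n. \<exists>j\<in>I. n \<le> j \<and> f j < \<epsilon>"
    proof (rule ccontr)
      assume "\<not> ?thesis"
      then obtain \<epsilon> n where e: "\<epsilon> > 0" "\<forall>j\<in>I. n \<le> j \<longrightarrow> \<not> f j < \<epsilon>" by blast
      have "ereal \<epsilon> \<le> Liminf (at_top_in I) (\<lambda>j. ereal (f j))"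
        by (rule Liminf_bounded) (use e in \<open>auto simp: ev not_less\<close>)
      then show False using L e(1) by (simp add: zero_ereal_def)
    qed
  next
    assume R: "\<forall>\<epsilon>>0. \<forall>n. \<exists>j\<in>I. n \<le> j \<and> f j < \<epsilon>"
    show "Liminf (at_top_in I) (\<lambda>j. ereal (f j)) = 0"
    proof (rule ccontr)
      assume "\<not> ?thesis"
      then have "0 < Liminf (at_top_in I) (\<lambda>j. ereal (f j))" using ge by simp
      then obtain y where "0 < ereal y" "ereal y < Liminf (at_top_in I) (\<lambda>j. ereal (f j))"
        using ereal_dense2 by blast
      then have "0 < y" and e: "eventually (\<lambda>j. ereal y < ereal (f j)) (at_top_in I)"
        using less_LiminfD[of "ereal y"] by (simp add: zero_ereal_def, blast)
      from e obtain n where "\<forall>j\<in>I. n \<le> j \<longrightarrow> y < f j" by (auto simp: ev)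
      then show False using R \<open>0 < y\<close> by (meson less_asym)
    qed
  qed
qed

text \<open>Along a thick set a null sequence is small on intervals of any length, arbitrarily far out.\<close>

lemma at_top_in_thick_block:
  assumes I: "thick I" and lim: "(f \<longlongrightarrow> 0) (at_top_in I)" and e: "(\<epsilon>::real) > 0"
  shows "\<exists>j\<ge>L. \<forall>i\<in>{j..j + q}. f i < \<epsilon>"
proof -
  have "eventually (\<lambda>j. f j < \<epsilon>) (at_top_in I)" using order_tendstoD(2)[OF lim e] .
  then obtain J where J: "\<And>j. j \<in> I \<Longrightarrow> J \<le> j \<Longrightarrow> f j < \<epsilon>"
    by (auto simp: at_top_in_def eventually_inf_principal eventually_at_top_linorder)
  have "J + L + q + 1 \<ge> 1" by simp
  then obtain j where j: "{j..j + (J + L + q + 1)} \<subseteq> I" using I unfolding thick_def by blast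
  show ?thesis
  proof (intro exI[of _ "j + J + L"] conjI ballI)
    fix i assume "i \<in> {j + J + L..j + J + L + q}"
    then show "f i < \<epsilon>" using j by (intro J) auto
  qed simp
qed

lemma sum_le_sum_support:
  fixes f :: "'b \<Rightarrow> real"
  assumes "finite A" "finite S" "\<And>j. j \<notin> S \<Longrightarrow> f j = 0" "\<And>j. 0 \<le> f j"
  shows "sum f A \<le> sum f S"
proof -
  have "sum f A = sum f (A \<inter> S)"
    by (rule sum.mono_neutral_right) (use assms in auto)
  also have "\<dots> \<le> sum f S" by (rule sum_mono2) (use assms in auto)
  finally show ?thesis .
qed

lemma sum_half_powers_le: "(\<Sum>l=Suc k..M. (1/2::real) ^ l) \<le> (1/2) ^ k"
proof (cases "k \<le> M")
  case True
  then have "(\<Sum>l=Suc k..M. (1/2::real) ^ l) = (1/2) ^ k - (1/2) ^ M"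
  proof (induction M rule: dec_induct)
    case (step M)
    have "{Suc k..Suc M} = insert (Suc M) {Suc k..M}" using step by auto
    then show ?case using step by simp
  qed simp
  then show ?thesis by simp
qed simp


section \<open>Continuous seminorms on the inductive limit\<close>

text \<open>Seminorms on a space of sequences; the values outside of \<open>E\<close> are irrelevant.\<close>

definition seminorm_on :: "(nat \<Rightarrow> 'a::real_normed_field) set \<Rightarrow> ((nat \<Rightarrow> 'a) \<Rightarrow> real) \<Rightarrow> bool" where
  "seminorm_on E q \<longleftrightarrow> (\<forall>x\<in>E. \<forall>y\<in>E. q (\<lambda>j. x j + y j) \<le> q x + q y)
     \<and> (\<forall>c. \<forall>x\<in>E. q (\<lambda>j. c * x j) = norm c * q x)"

text \<open>The topology on \<open>E\<close> that is generated by the open balls of a seminorm.\<close>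

definition seminorm_topology :: "(nat \<Rightarrow> 'a::real_normed_field) set \<Rightarrow> ((nat \<Rightarrow> 'a) \<Rightarrow> real) \<Rightarrow> (nat \<Rightarrow> 'a) topology" where
  "seminorm_topology E q = topology (\<lambda>U. U \<subseteq> E \<and>
     (\<forall>a\<in>U. \<exists>r>0. \<forall>x\<in>E. q (\<lambda>j. x j - a j) < r \<longrightarrow> x \<in> U))"

lemma openin_seminorm_topology:
  "openin (seminorm_topology E q) U \<longleftrightarrow> U \<subseteq> E \<and>
     (\<forall>a\<in>U. \<exists>r>0. \<forall>x\<in>E. q (\<lambda>j. x j - a j) < r \<longrightarrow> x \<in> U)"
proof -
  let ?P = "\<lambda>U. U \<subseteq> E \<and> (\<forall>a\<in>U. \<exists>r>0. \<forall>x\<in>E. q (\<lambda>j. x j - a j) < r \<longrightarrow> x \<in> U)"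
  have "istopology ?P"
    unfolding istopology_def
  proof (intro conjI allI impI)
    fix S T assume S: "?P S" and T: "?P T"
    show "S \<inter> T \<subseteq> E" using S by blast
    show "\<forall>a\<in>S \<inter> T. \<exists>r>0. \<forall>x\<in>E. q (\<lambda>j. x j - a j) < r \<longrightarrow> x \<in> S \<inter> T"
    proof
      fix a assume "a \<in> S \<inter> T"
      then obtain r s where "r > 0" "\<forall>x\<in>E. q (\<lambda>j. x j - a j) < r \<longrightarrow> x \<in> S"
        "s > 0" "\<forall>x\<in>E. q (\<lambda>j. x j - a j) < s \<longrightarrow> x \<in> T"
        using S T by blast
      then show "\<exists>r>0. \<forall>x\<in>E. q (\<lambda>j. x j - a j) < r \<longrightarrow> x \<in> S \<inter> T"
        by (intro exI[of _ "min r s"]) auto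
    qed
  next
    fix K assume K: "\<forall>S\<in>K. ?P S"
    show "\<Union>K \<subseteq> E" using K by blast
    show "\<forall>a\<in>\<Union>K. \<exists>r>0. \<forall>x\<in>E. q (\<lambda>j. x j - a j) < r \<longrightarrow> x \<in> \<Union>K"
      using K by (meson UnionE UnionI)
  qed
  then show ?thesis unfolding seminorm_topology_def by (simp add: topology_inverse')
qed

lemma seq_subspaceD:
  assumes "seq_subspace E"
  shows "(\<lambda>j. 0) \<in> E" and "\<And>x y. x \<in> E \<Longrightarrow> y \<in> E \<Longrightarrow> (\<lambda>j. x j + y j) \<in> E"
    and "\<And>c x. x \<in> E \<Longrightarrow> (\<lambda>j. c * x j) \<in> E"
  using assms by (auto simp: seq_subspace_def)

lemma seminorm_onD:
  assumes "seminorm_on E q"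
  shows "\<And>x y. x \<in> E \<Longrightarrow> y \<in> E \<Longrightarrow> q (\<lambda>j. x j + y j) \<le> q x + q y"
    and "\<And>c x. x \<in> E \<Longrightarrow> q (\<lambda>j. c * x j) = norm c * q x"
  using assms by (auto simp: seminorm_on_def)

lemma seq_subspace_diff:
  assumes "seq_subspace E" "x \<in> E" "y \<in> E"
  shows "(\<lambda>j. x j - y j) \<in> E"
  using seq_subspaceD(2)[OF assms(1,2) seq_subspaceD(3)[OF assms(1,3), of "- 1"]] by simp

lemma seminorm_on_zero:
  assumes "seq_subspace E" "seminorm_on E q"
  shows "q (\<lambda>j. 0) = 0"
  using seminorm_onD(2)[OF assms(2) seq_subspaceD(1)[OF assms(1)], of 0] by simp

lemma seminorm_on_nonneg:
  assumes "seq_subspace E" "seminorm_on E q" "x \<in> E"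
  shows "0 \<le> q x"
proof -
  have "(\<lambda>j. - 1 * x j) \<in> E" by (rule seq_subspaceD(3)[OF assms(1,3)])
  from seminorm_onD(1)[OF assms(2,3) this] seminorm_onD(2)[OF assms(2,3), of "- 1"]
  show ?thesis using seminorm_on_zero[OF assms(1,2)] by simp
qed

lemma openin_seminorm_ball:
  assumes E: "seq_subspace E" and q: "seminorm_on E q" and a: "a \<in> E"
  shows "openin (seminorm_topology E q) {x \<in> E. q (\<lambda>j. x j - a j) < r}"
  unfolding openin_seminorm_topology
proof (intro conjI ballI)
  fix b assume b: "b \<in> {x \<in> E. q (\<lambda>j. x j - a j) < r}"
  show "\<exists>s>0. \<forall>x\<in>E. q (\<lambda>j. x j - b j) < s \<longrightarrow> x \<in> {x \<in> E. q (\<lambda>j. x j - a j) < r}"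
  proof (intro exI conjI ballI impI)
    show "r - q (\<lambda>j. b j - a j) > 0" using b by simp
    fix x assume x: "x \<in> E" "q (\<lambda>j. x j - b j) < r - q (\<lambda>j. b j - a j)"
    have "(\<lambda>j. x j - b j) \<in> E" "(\<lambda>j. b j - a j) \<in> E"
      using x a b seq_subspace_diff[OF E] by auto
    then have "q (\<lambda>j. (x j - b j) + (b j - a j)) \<le> q (\<lambda>j. x j - b j) + q (\<lambda>j. b j - a j)"
      by (rule seminorm_onD(1)[OF q])
    then show "x \<in> {x \<in> E. q (\<lambda>j. x j - a j) < r}" using x by simp
  qed
qed auto

lemma locally_convex_seminorm_topology:
  assumes E: "seq_subspace E" and q: "seminorm_on E q"
  shows "locally_convex_topology E (seminorm_topology E q)"
proof -
  let ?T = "seminorm_topology E q"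
  have sub: "x \<in> E \<Longrightarrow> y \<in> E \<Longrightarrow> (\<lambda>j. x j - y j) \<in> E" for x y
    using seq_subspace_diff[OF E] .
  have sc: "x \<in> E \<Longrightarrow> (\<lambda>j. c * x j) \<in> E" and add: "x \<in> E \<Longrightarrow> y \<in> E \<Longrightarrow> (\<lambda>j. x j + y j) \<in> E" for x y c
    using seq_subspaceD[OF E] by blast+
  have tri: "x \<in> E \<Longrightarrow> y \<in> E \<Longrightarrow> q (\<lambda>j. x j + y j) \<le> q x + q y"
    and hom: "x \<in> E \<Longrightarrow> q (\<lambda>j. c * x j) = norm c * q x" for x y c
    using seminorm_onD[OF q] by blast+
  have "openin ?T E" by (auto simp: openin_seminorm_topology intro: exI[of _ 1])
  then have ts: "topspace ?T = E"
    by (metis openin_seminorm_topology openin_subset openin_topspace subset_antisym)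
  have "continuous_map (prod_topology ?T ?T) ?T (\<lambda>(x, y). \<lambda>j. x j + y j)"
    unfolding continuous_map_def
  proof (intro conjI allI impI)
    show "(\<lambda>(x, y). \<lambda>j. x j + y j) \<in> topspace (prod_topology ?T ?T) \<rightarrow> topspace ?T"
      using add by (auto simp: ts)
    fix U assume U: "openin ?T U"
    show "openin (prod_topology ?T ?T) {z \<in> topspace (prod_topology ?T ?T). (case z of (x, y) \<Rightarrow> \<lambda>j. x j + y j) \<in> U}"
      unfolding openin_prod_topology_alt
    proof (intro allI impI)
      fix a b assume "(a, b) \<in> {z \<in> topspace (prod_topology ?T ?T). (case z of (x, y) \<Rightarrow> \<lambda>j. x j + y j) \<in> U}"
      then have ab: "a \<in> E" "b \<in> E" "(\<lambda>j. a j + b j) \<in> U" by (auto simp: ts)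
      then obtain r where r: "r > 0" "\<And>x. x \<in> E \<Longrightarrow> q (\<lambda>j. x j - (a j + b j)) < r \<Longrightarrow> x \<in> U"
        using U unfolding openin_seminorm_topology by metis
      let ?A = "{x \<in> E. q (\<lambda>j. x j - a j) < r / 2}" and ?B = "{x \<in> E. q (\<lambda>j. x j - b j) < r / 2}"
      have "(\<lambda>j. x j + y j) \<in> U" if "x \<in> ?A" "y \<in> ?B" for x y
      proof (rule r(2))
        have eq: "(\<lambda>j. (x j - a j) + (y j - b j)) = (\<lambda>j. x j + y j - (a j + b j))"
          by (simp add: fun_eq_iff)
        have "q (\<lambda>j. (x j - a j) + (y j - b j)) \<le> q (\<lambda>j. x j - a j) + q (\<lambda>j. y j - b j)"
          by (rule tri; rule sub) (use that ab in simp_all)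
        also have "\<dots> < r" using that by simp
        finally show "q (\<lambda>j. x j + y j - (a j + b j)) < r" unfolding eq .
      qed (use that add in auto)
      moreover have "openin ?T ?A" "openin ?T ?B"
        using openin_seminorm_ball[OF E q] ab by blast+
      moreover have "a \<in> ?A" "b \<in> ?B"
        using ab r seminorm_on_zero[OF E q] by auto
      ultimately show "\<exists>A B. openin ?T A \<and> openin ?T B \<and> a \<in> A \<and> b \<in> B \<and>
          A \<times> B \<subseteq> {z \<in> topspace (prod_topology ?T ?T). (case z of (x, y) \<Rightarrow> \<lambda>j. x j + y j) \<in> U}"
        by (intro exI[of _ ?A] exI[of _ ?B]) (auto simp: ts)
    qed
  qed
  moreover have "continuous_map (prod_topology euclidean ?T) ?T (\<lambda>(c, x). \<lambda>j. c * x j)"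
    unfolding continuous_map_def
  proof (intro conjI allI impI)
    show "(\<lambda>(c, x). \<lambda>j. c * x j) \<in> topspace (prod_topology euclidean ?T) \<rightarrow> topspace ?T"
      using sc by (auto simp: ts)
    fix U assume U: "openin ?T U"
    show "openin (prod_topology euclidean ?T) {z \<in> topspace (prod_topology euclidean ?T). (case z of (c, x) \<Rightarrow> \<lambda>j. c * x j) \<in> U}"
      unfolding openin_prod_topology_alt
    proof (intro allI impI)
      fix c a assume "(c, a) \<in> {z \<in> topspace (prod_topology euclidean ?T). (case z of (c, x) \<Rightarrow> \<lambda>j. c * x j) \<in> U}"
      then have ca: "a \<in> E" "(\<lambda>j. c * a j) \<in> U" by (auto simp: ts)
      then obtain r where r: "r > 0" "\<And>x. x \<in> E \<Longrightarrow> q (\<lambda>j. x j - c * a j) < r \<Longrightarrow> x \<in> U"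
        using U unfolding openin_seminorm_topology by metis
      have qa: "0 \<le> q a" using seminorm_on_nonneg[OF E q ca(1)] .
      define d where "d = min 1 (r / (2 * (q a + 1)))"
      have d: "0 < d" "d \<le> 1" and "d \<le> r / (2 * (q a + 1))"
        using r(1) qa by (auto simp: d_def)
      then have dq: "d * (q a + 1) \<le> r / 2"
        using qa by (simp add: field_simps)
      define s where "s = r / (2 * (norm c + 1))"
      have "0 < norm c + 1" by (simp add: add_nonneg_pos)
      then have s: "0 < s" "(norm c + 1) * s = r / 2" using r(1) by (auto simp: s_def field_simps)
      let ?A = "ball c d" and ?B = "{x \<in> E. q (\<lambda>j. x j - a j) < s}"
      have "(\<lambda>j. e * x j) \<in> U" if e: "e \<in> ?A" and x: "x \<in> ?B" for e x
      proof (rule r(2))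
        have ec: "norm (e - c) < d" using e by (simp add: dist_norm norm_minus_commute)
        then have e1: "norm e \<le> norm c + 1" using d norm_triangle_ineq2[of e c] by linarith
        have "q (\<lambda>j. e * (x j - a j) + (e - c) * a j) \<le> q (\<lambda>j. e * (x j - a j)) + q (\<lambda>j. (e - c) * a j)"
          by (rule tri; rule sc) (use x ca sub in auto)
        also have "\<dots> = norm e * q (\<lambda>j. x j - a j) + norm (e - c) * q a"
          using hom[of "\<lambda>j. x j - a j" e] hom[of a "e - c"] x ca sub by simp
        also have "\<dots> \<le> (norm c + 1) * q (\<lambda>j. x j - a j) + d * q a"
          using e1 ec qa seminorm_on_nonneg[OF E q sub[of x a]] x ca
          by (intro add_mono mult_right_mono) auto
        also have "\<dots> < (norm c + 1) * s + d * (q a + 1)"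
          using x d \<open>0 < norm c + 1\<close> by (intro add_strict_mono mult_strict_left_mono) auto
        also have "\<dots> \<le> r" using s dq by simp
        finally have "q (\<lambda>j. e * (x j - a j) + (e - c) * a j) < r" .
        also have "(\<lambda>j. e * (x j - a j) + (e - c) * a j) = (\<lambda>j. e * x j - c * a j)"
          by (simp add: fun_eq_iff algebra_simps)
        finally show "q (\<lambda>j. e * x j - c * a j) < r" .
      qed (use x sc in auto)
      moreover have "openin euclidean ?A" "openin ?T ?B" "c \<in> ?A" "a \<in> ?B"
        using ca d s openin_seminorm_ball[OF E q] seminorm_on_zero[OF E q] by auto
      ultimately show "\<exists>A B. openin euclidean A \<and> openin ?T B \<and> c \<in> A \<and> a \<in> B \<and>
          A \<times> B \<subseteq> {z \<in> topspace (prod_topology euclidean ?T). (case z of (c, x) \<Rightarrow> \<lambda>j. c * x j) \<in> U}"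
        by (intro exI[of _ ?A] exI[of _ ?B]) (auto simp: ts)
    qed
  qed
  moreover have "\<exists>C W. seq_convex C \<and> openin ?T W \<and> (\<lambda>j. 0) \<in> W \<and> W \<subseteq> C \<and> C \<subseteq> U"
    if U: "openin ?T U" "(\<lambda>j. 0) \<in> U" for U
  proof -
    have "\<forall>a\<in>U. \<exists>r>0. \<forall>x\<in>E. q (\<lambda>j. x j - a j) < r \<longrightarrow> x \<in> U"
      using U(1) by (simp add: openin_seminorm_topology)
    from bspec[OF this U(2)]
    obtain r where r: "r > 0" "\<And>x. x \<in> E \<Longrightarrow> q x < r \<Longrightarrow> x \<in> U" by auto
    let ?W = "{x \<in> E. q x < r}"
    have "seq_convex ?W"
      unfolding seq_convex_def
    proof (intro ballI)
      fix x y and t :: real assume x: "x \<in> ?W" and y: "y \<in> ?W" and t: "t \<in> {0..1}"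
      let ?x = "\<lambda>j. of_real (1 - t) * x j" and ?y = "\<lambda>j. of_real t * y j"
      have E': "?x \<in> E" "?y \<in> E" using x y sc by auto
      have "q (\<lambda>j. ?x j + ?y j) \<le> q ?x + q ?y" by (rule tri[OF E'])
      also have "\<dots> = (1 - t) * q x + t * q y" using x y t hom by (simp del: of_real_diff)
      also have "\<dots> < r"
        using convex_bound_lt[of "q x" r "q y" "1 - t" t] x y t by simp
      finally have "(\<lambda>j. ?x j + ?y j) \<in> ?W" using add[OF E'] by simp
      then show "(\<lambda>j. (1 - t) *\<^sub>R x j + t *\<^sub>R y j) \<in> ?W" by (simp only: scaleR_conv_of_real)
    qed
    moreover have z: "(\<lambda>j. 0) \<in> E" using E by (simp add: seq_subspace_def)
    moreover have "openin ?T ?W" using openin_seminorm_ball[OF E q z, of r] by simp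
    ultimately show ?thesis
      using r seminorm_on_zero[OF E q] by (intro exI[of _ ?W] conjI) auto
  qed
  ultimately show ?thesis
    unfolding locally_convex_topology_def using E ts by simp
qed

text \<open>A seminorm that is bounded on every step by a multiple of the norm of the step generates a
  locally convex topology that makes the inclusions of the steps continuous.  The topology of the
  inductive limit is finer, so the balls of such a seminorm are open in it.\<close>

lemma openin_coechelon_seminorm_ball:
  fixes q :: "(nat \<Rightarrow> 'a::real_normed_field) \<Rightarrow> real"
  assumes p: "p = 0 \<or> 1 \<le> p" and V: "decreasing_positive_weights V"
    and q: "seminorm_on (coechelon_space p V) q"
    and bound: "\<And>m. \<exists>C. \<forall>x\<in>weighted_lp p (V m). q x \<le> C * lp_norm p (\<lambda>j. V m j *\<^sub>R x j)"
    and a: "a \<in> coechelon_space p V"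
  shows "openin (coechelon_topology p V) {x \<in> coechelon_space p V. q (\<lambda>j. x j - a j) < r}"
proof -
  let ?E = "coechelon_space p V :: (nat \<Rightarrow> 'a) set"
  let ?T = "seminorm_topology ?E q"
  have pos: "0 < V m j" for m j using V by (simp add: decreasing_positive_weights_def)
  have ts: "topspace (weighted_lp_topology p (V m) :: (nat \<Rightarrow> 'a) topology) = weighted_lp p (V m)" for m
    by (rule topspace_weighted_lp_topology[OF p pos])
  have E: "seq_subspace ?E"
    using coechelon_topology(1)[OF p V, where 'a = 'a] by (simp add: locally_convex_topology_def)
  have "continuous_map (weighted_lp_topology p (V m)) ?T (\<lambda>x. x)" for m
    unfolding continuous_map_def
  proof (intro conjI allI impI)
    interpret M: Metric_space "weighted_lp p (V m) :: (nat \<Rightarrow> 'a) set" "weighted_lp_dist p (V m)"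
      by (rule Metric_space_weighted_lp[OF p pos])
    show "(\<lambda>x. x) \<in> topspace (weighted_lp_topology p (V m)) \<rightarrow> topspace ?T"
      using locally_convex_seminorm_topology[OF E q]
      by (auto simp: ts locally_convex_topology_def coechelon_space_def)
    fix U assume U: "openin ?T U"
    show "openin (weighted_lp_topology p (V m)) {x \<in> topspace (weighted_lp_topology p (V m)). x \<in> U}"
      unfolding ts unfolding weighted_lp_topology_def M.openin_mtopology
    proof (intro conjI allI impI)
      fix x assume x: "x \<in> {x \<in> weighted_lp p (V m). x \<in> U}"
      obtain r where r: "r > 0" "\<And>y. y \<in> ?E \<Longrightarrow> q (\<lambda>j. y j - x j) < r \<Longrightarrow> y \<in> U"
        using x U unfolding openin_seminorm_topology by blast
      obtain C where C: "\<And>x. x\<in>weighted_lp p (V m) \<Longrightarrow> q x \<le> C * lp_norm p (\<lambda>j. V m j *\<^sub>R x j)"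
        using bound by blast
      have "M.mball x (r / (\<bar>C\<bar> + 1)) \<subseteq> {x \<in> weighted_lp p (V m). x \<in> U}"
      proof
        fix y assume y: "y \<in> M.mball x (r / (\<bar>C\<bar> + 1))"
        let ?n = "lp_norm p (\<lambda>j. V m j *\<^sub>R (y j - x j))"
        have ym: "y \<in> weighted_lp p (V m)" and "weighted_lp_dist p (V m) y x < r / (\<bar>C\<bar> + 1)"
          using y M.commute[of x y] by auto
        then have n: "?n * (\<bar>C\<bar> + 1) < r"
          by (simp add: weighted_lp_dist_def pos_less_divide_eq)
        have "(\<lambda>j. y j - x j) \<in> weighted_lp p (V m)"
          using lp_space_add_norm[of "\<lambda>j. V m j *\<^sub>R y j" p "\<lambda>j. - (V m j *\<^sub>R x j)"] p x ym
            lp_space_uminus[of "\<lambda>j. V m j *\<^sub>R x j" p]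
          by (simp add: weighted_lp_def scaleR_diff_right)
        then have "q (\<lambda>j. y j - x j) \<le> C * ?n" by (rule C)
        also have "\<dots> \<le> (\<bar>C\<bar> + 1) * ?n" by (intro mult_right_mono lp_norm_nonneg) simp
        also have "\<dots> < r" using n by (simp add: mult.commute)
        finally show "y \<in> {x \<in> weighted_lp p (V m). x \<in> U}"
          using ym by (auto simp: coechelon_space_def intro!: r(2))
      qed
      then show "\<exists>r>0. M.mball x r \<subseteq> {x \<in> weighted_lp p (V m). x \<in> U}"
        using r(1) by (intro exI[of _ "r / (\<bar>C\<bar> + 1)"]) auto
    qed auto
  qed
  then have "admissible_lc_topology (\<lambda>m. weighted_lp_topology p (V m)) ?T"
    using locally_convex_seminorm_topology[OF E q]
    by (simp add: admissible_lc_topology_def ts coechelon_space_def)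
  then show ?thesis
    unfolding coechelon_topology_def
    by (rule lc_inductive_limit_finest) (rule openin_seminorm_ball[OF E q a])
qed


section \<open>The shift in rescaled coordinates\<close>

text \<open>A weighted generalized backward shift that acts continuously on a coechelon space.  Of the
  scalar field only the norm and the separability are needed, the latter for the construction of a
  hypercyclic vector.\<close>

locale coechelon_shift =
  fixes \<psi> :: "nat \<Rightarrow> nat"
    and w :: "nat \<Rightarrow> 'a::{real_normed_field, second_countable_topology}"
    and V :: "nat \<Rightarrow> nat \<Rightarrow> real"
    and p :: real
  assumes symbol: "is_symbol \<psi>"
    and weight: "weight_sequence w"
    and V: "decreasing_positive_weights V"
    and p: "p = 0 \<or> 1 \<le> p"
    and op: "continuous_linear_operator (coechelon_topology p V :: (nat \<Rightarrow> 'a) topology) (weighted_shift w \<psi>)"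
begin

abbreviation "E \<equiv> (coechelon_space p V :: (nat \<Rightarrow> 'a) set)"
abbreviation "k \<equiv> (coechelon_topology p V :: (nat \<Rightarrow> 'a) topology)"
abbreviation "B \<equiv> weighted_shift w \<psi>"
abbreviation "u \<equiv> u_quot w \<psi> V"
abbreviation step :: "nat \<Rightarrow> (nat \<Rightarrow> 'a) set" where "step m \<equiv> weighted_lp p (V m)"

text \<open>The index \<open>\<psi>\<^sup>j(0)\<close>, which is the \<open>j\<close>-th one, counted from \<open>0\<close>, in the order given by the symbol.\<close>

definition orb :: "nat \<Rightarrow> nat" where "orb j = (\<psi> ^^ j) 0"

text \<open>The product of the first \<open>j + 1\<close> weights along this order; its modulus is the denominator
  of \<open>u m j\<close>.\<close>

definition wprod :: "nat \<Rightarrow> 'a" where "wprod j = (\<Prod>l=0..j. w (orb l))"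

text \<open>The coordinates in which \<open>B\<close> is the unweighted backward shift.\<close>

definition coord :: "(nat \<Rightarrow> 'a) \<Rightarrow> nat \<Rightarrow> 'a" where "coord x = (\<lambda>j. wprod j * x (orb j))"

text \<open>The vector with given coordinates, the inverse of \<open>coord\<close>.\<close>

definition frame :: "(nat \<Rightarrow> 'a) \<Rightarrow> nat \<Rightarrow> 'a" where
  "frame y = (\<lambda>i. y (inv orb i) / wprod (inv orb i))"

text \<open>The norm of the \<open>m\<close>-th step.\<close>

definition nrm :: "nat \<Rightarrow> (nat \<Rightarrow> 'a) \<Rightarrow> real" where "nrm m x = lp_norm p (\<lambda>j. V m j *\<^sub>R x j)"

lemma bij_orb: "bij orb"
proof (rule bijI)
  have inj: "inj \<psi>" and r: "range \<psi> = UNIV - {0}"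
    and surj: "UNIV = {0} \<union> (\<Union>n\<in>{1..}. {(\<psi> ^^ n) 0})"
    using symbol by (auto simp: is_symbol_def bij_betw_def)
  have *: "j = l" if "j \<le> l" "(\<psi> ^^ j) 0 = (\<psi> ^^ l) 0" for j l
  proof (rule ccontr)
    assume "j \<noteq> l"
    then obtain d where d: "l = j + Suc d" using \<open>j \<le> l\<close> less_imp_Suc_add[of j l] by auto
    have "(\<psi> ^^ j) 0 = (\<psi> ^^ j) ((\<psi> ^^ Suc d) 0)" using that d by (simp only: funpow_add o_apply)
    then have "0 = (\<psi> ^^ Suc d) 0" using injD[OF inj_fn[OF inj]] by blast
    then have "0 = \<psi> ((\<psi> ^^ d) 0)" by simp
    then show False using r by (metis DiffD2 insertI1 rangeI)
  qed
  show "inj orb"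
  proof (rule injI)
    fix j l assume "orb j = orb l"
    then show "j = l" using *[of j l] *[of l j] by (cases "j \<le> l") (auto simp: orb_def)
  qed
  have "i \<in> range orb" for i
  proof -
    have "i = (\<psi> ^^ 0) 0 \<or> (\<exists>n. i = (\<psi> ^^ n) 0)" using surj by auto
    then show ?thesis unfolding orb_def by blast
  qed
  then show "surj orb" by blast
qed

lemma inv_orb [simp]: "inv orb (orb j) = j" "orb (inv orb i) = i"
  using bij_orb by (auto simp: bij_is_inj bij_is_surj surj_f_inv_f)

lemma wprod_nonzero [simp]: "wprod j \<noteq> 0"
  using weight by (simp add: wprod_def weight_sequence_def)

lemma V_pos [simp]: "0 < V m j"
  using V by (simp add: decreasing_positive_weights_def)

lemma V_antimono: "m \<le> n \<Longrightarrow> V n j \<le> V m j"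
  using lift_Suc_antimono_le[of "\<lambda>m. V m j"] V by (simp add: decreasing_positive_weights_def)

lemma u_eq: "u m j = V m (orb j) / norm (wprod j)"
  by (simp add: u_quot_def orb_def wprod_def prod_norm)

lemma u_pos [simp]: "0 < u m j"
  by (simp add: u_eq)

lemma coord_frame [simp]: "coord (frame y) = y"
  by (simp add: coord_def frame_def fun_eq_iff)

lemma frame_coord [simp]: "frame (coord x) = x"
  by (simp add: coord_def frame_def fun_eq_iff)

lemma coord_inject: "coord x = coord y \<longleftrightarrow> x = y"
  by (metis frame_coord)

lemma coord_linear [simp]:
  "coord (\<lambda>i. x i + y i) = (\<lambda>j. coord x j + coord y j)"
  "coord (\<lambda>i. x i - y i) = (\<lambda>j. coord x j - coord y j)"
  "coord (\<lambda>i. c * x i) = (\<lambda>j. c * coord x j)"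
  "coord (\<lambda>i. - x i) = (\<lambda>j. - coord x j)"
  "coord (\<lambda>i. 0) = (\<lambda>j. 0)"
  by (auto simp: coord_def algebra_simps)

lemma coord_shift: "coord (B x) j = coord x (Suc j)"
  by (simp add: coord_def weighted_shift_def wprod_def orb_def)

lemma coord_shift_iterate: "coord ((B ^^ n) x) j = coord x (j + n)"
  by (induction n arbitrary: j) (simp_all add: coord_shift)

text \<open>In coordinates, the \<open>m\<close>-th step is the weighted space with weight \<open>u m\<close>.\<close>

lemma step_coord: "x \<in> step m \<longleftrightarrow> (\<lambda>j. u m j *\<^sub>R coord x j) \<in> lp_space p"
  and nrm_coord: "nrm m x = lp_norm p (\<lambda>j. u m j *\<^sub>R coord x j)"
proof -
  let ?y = "\<lambda>j. V m j *\<^sub>R x j"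
  have "norm (u m j *\<^sub>R coord x j) = norm (?y (orb j))" for j
    by (simp add: u_eq coord_def norm_mult)
  from lp_cong_norm[where x = "\<lambda>j. u m j *\<^sub>R coord x j" and y = "\<lambda>j. ?y (orb j)" and p = p, OF this]
    lp_reindex_bij[OF bij_orb, where x = ?y and p = p]
  show "x \<in> step m \<longleftrightarrow> (\<lambda>j. u m j *\<^sub>R coord x j) \<in> lp_space p"
    "nrm m x = lp_norm p (\<lambda>j. u m j *\<^sub>R coord x j)"
    by (simp_all add: weighted_lp_def nrm_def)
qed

lemma coord_le_nrm: "x \<in> step m \<Longrightarrow> u m j * norm (coord x j) \<le> nrm m x"
  using norm_le_lp_norm[OF _ p, of "\<lambda>j. u m j *\<^sub>R coord x j" j]
  by (simp add: step_coord nrm_coord less_imp_le)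

lemma step_mono:
  assumes "x \<in> step m" "m \<le> n"
  shows "x \<in> step n" "nrm n x \<le> nrm m x"
proof -
  have le: "norm (V n j *\<^sub>R x j) \<le> norm (V m j *\<^sub>R x j)" for j
    using V_antimono[OF assms(2)] by (simp add: mult_right_mono less_imp_le)
  have "(\<lambda>j. V m j *\<^sub>R x j) \<in> lp_space p" using assms by (simp add: weighted_lp_def)
  from lp_space_dominated[OF this le p] show "x \<in> step n" "nrm n x \<le> nrm m x"
    by (simp_all add: weighted_lp_def nrm_def)
qed

lemma step_add:
  assumes "x \<in> step m" "y \<in> step m"
  shows "(\<lambda>i. x i + y i) \<in> step m" "nrm m (\<lambda>i. x i + y i) \<le> nrm m x + nrm m y"
  using lp_space_add_norm[of "\<lambda>j. V m j *\<^sub>R x j" p "\<lambda>j. V m j *\<^sub>R y j"] assms p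
  by (simp_all add: weighted_lp_def nrm_def scaleR_add_right)

lemma step_uminus: "x \<in> step m \<Longrightarrow> (\<lambda>i. - x i) \<in> step m"
  using lp_space_uminus[of "\<lambda>j. V m j *\<^sub>R x j" p] by (simp add: weighted_lp_def)

lemma frame_l1:
  assumes "\<And>n. (\<Sum>j<n. u m j * norm (y j)) \<le> s"
  shows "frame y \<in> step m" "nrm m (frame y) \<le> s"
  using lp_norm_le_l1[OF _ p, of "\<lambda>j. u m j *\<^sub>R y j" s] assms
  by (auto simp: step_coord nrm_coord less_imp_le)

lemma frame_finite:
  assumes "\<And>j. N \<le> j \<Longrightarrow> y j = 0"
  shows "frame y \<in> step m" "nrm m (frame y) \<le> (\<Sum>j<N. u m j * norm (y j))"
proof -
  have "(\<Sum>j<n. u m j * norm (y j)) \<le> (\<Sum>j<N. u m j * norm (y j))" for n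
    by (rule sum_le_sum_support) (simp_all add: assms less_imp_le)
  from frame_l1[OF this] show "frame y \<in> step m" "nrm m (frame y) \<le> (\<Sum>j<N. u m j * norm (y j))" .
qed

lemma nrm_tail_tendsto:
  assumes "x \<in> step m"
  shows "frame (\<lambda>j. if n \<le> j then coord x j else 0) \<in> step m"
    and "(\<lambda>n. nrm m (frame (\<lambda>j. if n \<le> j then coord x j else 0))) \<longlonglongrightarrow> 0"
proof -
  have eq: "(\<lambda>j. u m j *\<^sub>R (if n \<le> j then coord x j else 0)) = (\<lambda>j. if n \<le> j then u m j *\<^sub>R coord x j else 0)" for n
    by auto
  show "frame (\<lambda>j. if n \<le> j then coord x j else 0) \<in> step m"
    "(\<lambda>n. nrm m (frame (\<lambda>j. if n \<le> j then coord x j else 0))) \<longlonglongrightarrow> 0"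
    using lp_tail[OF _ p, of "\<lambda>j. u m j *\<^sub>R coord x j"] assms
    by (simp_all add: step_coord nrm_coord eq)
qed


section \<open>The topology of the coechelon space\<close>

lemma topspace_k [simp]: "topspace k = E"
  using coechelon_topology(3)[OF p V] .

lemma seq_subspace_E: "seq_subspace E"
  using coechelon_topology(1)[OF p V, where 'a = 'a] by (simp add: locally_convex_topology_def)

lemmas E_zero = seq_subspaceD(1)[OF seq_subspace_E]
  and E_scale = seq_subspaceD(3)[OF seq_subspace_E]

lemma step_subset_E: "x \<in> step m \<Longrightarrow> x \<in> E"
  by (auto simp: coechelon_space_def)

lemma E_cases:
  assumes "x \<in> E"
  obtains m where "x \<in> step m"
  using assms by (auto simp: coechelon_space_def)

lemma continuous_map_k_add:
  assumes "continuous_map X k f" "continuous_map X k g"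
  shows "continuous_map X k (\<lambda>x i. f x i + g x i)"
proof -
  have "continuous_map (prod_topology k k) k (\<lambda>(x, y) i. x i + y i)"
    using coechelon_topology(1)[OF p V, where 'a = 'a] by (simp add: locally_convex_topology_def)
  with continuous_map_pairedI[OF assms] have "continuous_map X k ((\<lambda>(x, y) i. x i + y i) \<circ> (\<lambda>x. (f x, g x)))"
    by (rule continuous_map_compose)
  then show ?thesis by (simp add: o_def)
qed

lemma continuous_map_k_scale:
  assumes "continuous_map X k f"
  shows "continuous_map X k (\<lambda>x i. c * f x i)"
proof -
  have 1: "continuous_map (prod_topology euclidean k) k (\<lambda>(c, x) i. c * x i)"
    using coechelon_topology(1)[OF p V, where 'a = 'a] by (simp add: locally_convex_topology_def)
  have "continuous_map X (prod_topology euclidean k) (\<lambda>x. (c, f x))"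
    by (rule continuous_map_pairedI) (use assms in auto)
  from continuous_map_compose[OF this 1] show ?thesis by (simp add: o_def)
qed

lemma continuous_map_k_sum:
  assumes "finite A" "\<And>s. s \<in> A \<Longrightarrow> continuous_map X k (f s)"
  shows "continuous_map X k (\<lambda>x i. \<Sum>s\<in>A. f s x i)"
  using assms
proof (induction A)
  case empty
  then show ?case by (simp add: E_zero)
next
  case (insert s A)
  then show ?case by (simp add: continuous_map_k_add)
qed

lemma continuous_map_B_iterate: "continuous_map k k (B ^^ n)"
proof (induction n)
  case (Suc n)
  have "continuous_map k k B" using op by (simp add: continuous_linear_operator_def)
  from continuous_map_compose[OF Suc this] show ?case by (simp add: o_def)
qed (simp add: id_def)

lemma B_iterate_in_E: "x \<in> E \<Longrightarrow> (B ^^ n) x \<in> E"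
  using continuous_map_B_iterate[of n] by (auto simp: continuous_map_def)

text \<open>Open sets enter the constructions of points only in this form: if the preimage of an open set
  under a continuous map contains \<open>0\<close>, then it contains a ball around \<open>0\<close> of each step.\<close>

lemma step_nhd:
  assumes U: "openin k U" and P: "continuous_map k k P" and 0: "P (\<lambda>i. 0) \<in> U"
  shows "\<exists>\<epsilon>>0. \<forall>z\<in>step m. nrm m z < \<epsilon> \<longrightarrow> P z \<in> U"
proof -
  interpret M: Metric_space "step m" "weighted_lp_dist p (V m)"
    by (rule Metric_space_weighted_lp[OF p V_pos])
  have z: "(\<lambda>i. 0) \<in> step m" by (simp add: weighted_lp_def lp_space_zero)
  have "continuous_map (weighted_lp_topology p (V m)) k (P \<circ> (\<lambda>x. x))"
    by (rule continuous_map_compose[OF coechelon_topology(2)[OF p V] P])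
  then have "openin (weighted_lp_topology p (V m)) {x \<in> topspace (weighted_lp_topology p (V m)). (P \<circ> (\<lambda>x. x)) x \<in> U}"
    using U by (rule openin_continuous_map_preimage)
  then have "openin M.mtopology {x \<in> step m. P x \<in> U}"
    by (simp add: weighted_lp_topology_def)
  then obtain r where "r > 0" "M.mball (\<lambda>i. 0) r \<subseteq> {x \<in> step m. P x \<in> U}"
    unfolding M.openin_mtopology using z 0 by blast
  moreover have "weighted_lp_dist p (V m) (\<lambda>i. 0) x = nrm m x" for x
    by (subst M.commute) (simp add: weighted_lp_dist_def nrm_def)
  ultimately show ?thesis using z by (intro exI[of _ r]) auto
qed

lemma step_nhd_add:
  assumes U: "openin k U" and a: "a \<in> U"
  shows "\<exists>\<epsilon>>0. \<forall>z\<in>step m. nrm m z < \<epsilon> \<longrightarrow> (\<lambda>i. a i + z i) \<in> U"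
proof -
  have "a \<in> E" using openin_subset[OF U] a by auto
  then have "continuous_map k k (\<lambda>z i. a i + z i)"
    by (intro continuous_map_k_add) auto
  from step_nhd[OF U this] a show ?thesis by simp
qed

lemma limitin_step:
  assumes a: "a \<in> E" and z: "\<And>s. z s \<in> step m" and lim: "(\<lambda>s. nrm m (z s)) \<longlonglongrightarrow> 0"
  shows "limitin k (\<lambda>s i. a i + z s i) a sequentially"
  unfolding limitin_def
proof (intro conjI allI impI)
  fix U assume U: "openin k U \<and> a \<in> U"
  then obtain \<epsilon> where e: "\<epsilon> > 0" "\<And>z. z \<in> step m \<Longrightarrow> nrm m z < \<epsilon> \<Longrightarrow> (\<lambda>i. a i + z i) \<in> U"
    using step_nhd_add by meson
  have "\<forall>\<^sub>F s in sequentially. nrm m (z s) < \<epsilon>"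
    using order_tendstoD(2)[OF lim e(1)] .
  then show "\<forall>\<^sub>F s in sequentially. (\<lambda>i. a i + z s i) \<in> U"
    by (rule eventually_mono) (use e(2) z in blast)
qed (use a in simp)

text \<open>Vectors with finitely many nonzero coordinates are dense.\<close>

lemma finite_vectors_dense:
  assumes U: "openin k U" and ne: "U \<noteq> {}"
  obtains x N where "x \<in> U" "\<And>j. N \<le> j \<Longrightarrow> coord x j = 0"
proof -
  obtain a where a: "a \<in> U" using ne by blast
  then have "a \<in> E" using openin_subset[OF U] by auto
  then obtain m where m: "a \<in> step m" by (rule E_cases)
  have m': "(\<lambda>i. - a i) \<in> step m" by (rule step_uminus[OF m])
  obtain \<epsilon> where e: "\<epsilon> > 0" "\<And>z. z \<in> step m \<Longrightarrow> nrm m z < \<epsilon> \<Longrightarrow> (\<lambda>i. a i + z i) \<in> U"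
    using step_nhd_add[OF U a] by meson
  have "\<forall>\<^sub>F n in sequentially. nrm m (frame (\<lambda>j. if n \<le> j then coord (\<lambda>i. - a i) j else 0)) < \<epsilon>"
    using order_tendstoD(2)[OF nrm_tail_tendsto(2)[OF m'] e(1)] .
  then obtain n where n: "nrm m (frame (\<lambda>j. if n \<le> j then coord (\<lambda>i. - a i) j else 0)) < \<epsilon>"
    by (auto simp: eventually_sequentially)
  let ?x = "\<lambda>i. a i + frame (\<lambda>j. if n \<le> j then coord (\<lambda>i. - a i) j else 0) i"
  have "?x \<in> U" by (rule e(2)[OF nrm_tail_tendsto(1)[OF m'] n])
  moreover have "coord ?x j = 0" if "n \<le> j" for j
    using that by simp
  ultimately show thesis by (rule that)
qed

text \<open>The seminorm \<open>sup\<^sub>j\<^sub>\<in>\<^sub>I |c\<^sub>j(x)|\<close>.  It is meaningful only when the coordinates of \<open>x\<close> are bounded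
  on \<open>I\<close>.\<close>

definition sup_coord :: "nat set \<Rightarrow> (nat \<Rightarrow> 'a) \<Rightarrow> real" where
  "sup_coord I x = (SUP j\<in>I. norm (coord x j))"

context
  fixes I :: "nat set"
  assumes I: "I \<noteq> {}" and below: "\<And>m. \<exists>c>0. \<forall>j\<in>I. c \<le> u m j"
begin

lemma coord_bounded_on:
  "\<exists>C. \<forall>x\<in>step m. \<forall>j\<in>I. norm (coord x j) \<le> C * nrm m x"
proof -
  obtain c where c: "c > 0" "\<And>j. j \<in> I \<Longrightarrow> c \<le> u m j" using below by blast
  have "norm (coord x j) \<le> (1 / c) * nrm m x" if "x \<in> step m" "j \<in> I" for x j
  proof -
    have "c * norm (coord x j) \<le> u m j * norm (coord x j)"
      using c(2)[OF that(2)] by (rule mult_right_mono) simp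
    also have "\<dots> \<le> nrm m x" by (rule coord_le_nrm[OF that(1)])
    finally show ?thesis using c(1) by (simp add: field_simps)
  qed
  then show ?thesis by blast
qed

lemma coord_le_sup_coord:
  assumes "x \<in> E" "j \<in> I"
  shows "norm (coord x j) \<le> sup_coord I x"
proof -
  obtain m where m: "x \<in> step m" using assms by (blast elim: E_cases)
  obtain C where "\<And>j. j \<in> I \<Longrightarrow> norm (coord x j) \<le> C * nrm m x"
    using coord_bounded_on[of m] m by blast
  then have "bdd_above ((\<lambda>j. norm (coord x j)) ` I)" by (intro bdd_aboveI2)
  then show ?thesis unfolding sup_coord_def using assms(2) by (intro cSUP_upper)
qed

lemma sup_coord_leI: "(\<And>j. j \<in> I \<Longrightarrow> norm (coord x j) \<le> s) \<Longrightarrow> sup_coord I x \<le> s"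
  unfolding sup_coord_def using I by (intro cSUP_least)

lemma sup_coord_seminorm: "seminorm_on E (sup_coord I)"
proof -
  have le: "sup_coord I (\<lambda>i. c * x i) \<le> norm c * sup_coord I x" if "x \<in> E" for c x
    by (rule sup_coord_leI) (use that in \<open>simp add: norm_mult mult_left_mono coord_le_sup_coord\<close>)
  have ge: "norm c * sup_coord I x \<le> sup_coord I (\<lambda>i. c * x i)" if "x \<in> E" for c x
  proof (cases "c = 0")
    case True
    obtain j where "j \<in> I" using I by blast
    from coord_le_sup_coord[OF E_zero this] show ?thesis using True by simp
  next
    case False
    have "sup_coord I (\<lambda>i. inverse c * (c * x i)) \<le> norm (inverse c) * sup_coord I (\<lambda>i. c * x i)"
      by (rule le[OF E_scale[OF that]])
    moreover have "(\<lambda>i. inverse c * (c * x i)) = x" using False by (simp add: fun_eq_iff)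
    ultimately have "sup_coord I x \<le> sup_coord I (\<lambda>i. c * x i) / norm c"
      by (simp add: norm_inverse divide_inverse mult.commute)
    then show ?thesis using False by (simp add: pos_le_divide_eq mult.commute)
  qed
  have "sup_coord I (\<lambda>i. x i + y i) \<le> sup_coord I x + sup_coord I y" if "x \<in> E" "y \<in> E" for x y
  proof (rule sup_coord_leI)
    fix j assume "j \<in> I"
    then have "norm (coord x j) + norm (coord y j) \<le> sup_coord I x + sup_coord I y"
      using that by (intro add_mono coord_le_sup_coord)
    then show "norm (coord (\<lambda>i. x i + y i) j) \<le> sup_coord I x + sup_coord I y"
      using norm_triangle_ineq[of "coord x j" "coord y j"] by simp
  qed
  then show ?thesis using le ge unfolding seminorm_on_def by (meson order_antisym)
qed

lemma openin_sup_coord_ball: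
  assumes "a \<in> E"
  shows "openin k {x \<in> E. sup_coord I (\<lambda>i. x i - a i) < r}"
proof (rule openin_coechelon_seminorm_ball[OF p V sup_coord_seminorm _ assms])
  fix m
  obtain C where C: "\<And>x j. x \<in> step m \<Longrightarrow> j \<in> I \<Longrightarrow> norm (coord x j) \<le> C * nrm m x"
    using coord_bounded_on[of m] by blast
  then show "\<exists>C. \<forall>x\<in>step m. sup_coord I x \<le> C * lp_norm p (\<lambda>j. V m j *\<^sub>R x j)"
    unfolding nrm_def[symmetric] using sup_coord_leI by blast
qed

end

lemma openin_coord_gt: "openin k {x \<in> E. r < norm (coord x i)}"
proof (subst openin_subopen, intro ballI)
  fix a assume a: "a \<in> {x \<in> E. r < norm (coord x i)}"
  let ?W = "{x \<in> E. sup_coord {i} (\<lambda>j. x j - a j) < norm (coord a i) - r}"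
  have below: "\<exists>c>0. \<forall>j\<in>{i}. c \<le> u m j" for m by (intro exI[of _ "u m i"]) auto
  have "openin k ?W" by (rule openin_sup_coord_ball[OF _ below]) (use a in auto)
  moreover have "a \<in> ?W" using a by (simp add: sup_coord_def)
  moreover have "?W \<subseteq> {x \<in> E. r < norm (coord x i)}"
  proof
    fix x assume x: "x \<in> ?W"
    then have "norm (coord x i - coord a i) < norm (coord a i) - r" by (simp add: sup_coord_def)
    moreover have "norm (coord a i) - norm (coord x i) \<le> norm (coord x i - coord a i)"
      by (metis norm_minus_commute norm_triangle_ineq2)
    ultimately show "x \<in> {x \<in> E. r < norm (coord x i)}" using x by simp
  qed
  ultimately show "\<exists>T. openin k T \<and> a \<in> T \<and> T \<subseteq> {x \<in> E. r < norm (coord x i)}" by blast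
qed

lemma frame_delta_in_E: "frame (\<lambda>j. if j = n then c else 0) \<in> E"
  by (rule step_subset_E[OF frame_finite(1)[of "Suc n"]]) auto


section \<open>Return sets\<close>

text \<open>If \<open>sup\<^sub>j\<^sub>\<in>\<^sub>I |c\<^sub>j(x)| < 1\<close>, then \<open>|c\<^sub>0(B\<^sup>j x)| = |c\<^sub>j(x)| < 1\<close> for all \<open>j \<in> I\<close>.\<close>

lemma no_return:
  assumes I: "I \<noteq> {}" and below: "\<And>m. \<exists>c>0. \<forall>j\<in>I. c \<le> u m j"
  obtains U W where "openin k U" "U \<noteq> {}" "openin k W" "W \<noteq> {}" "I \<inter> return_set B U W = {}"
proof
  let ?U = "{x \<in> E. sup_coord I (\<lambda>i. x i - 0) < 1}" and ?W = "{x \<in> E. 1 < norm (coord x 0)}"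
  show "openin k ?U" by (rule openin_sup_coord_ball[OF I below E_zero])
  have "sup_coord I (\<lambda>i. 0) = 0" using I by (simp add: sup_coord_def)
  then show "?U \<noteq> {}" using E_zero by auto
  show "openin k ?W" by (rule openin_coord_gt)
  have "frame (\<lambda>j. if j = 0 then 2 else 0) \<in> ?W" using frame_delta_in_E by simp
  then show "?W \<noteq> {}" by blast
  show "I \<inter> return_set B ?U ?W = {}"
  proof (rule ccontr)
    assume "\<not> ?thesis"
    then obtain j x where "j \<in> I" "x \<in> ?U" "1 < norm (coord ((B ^^ j) x) 0)"
      by (auto simp: return_set_def)
    then show False using coord_le_sup_coord[OF I below, of x j] by (simp add: coord_shift_iterate)
  qed
qed

text \<open>A single small value \<open>u m j\<close> yields a return time at a fixed distance from \<open>j\<close>.\<close>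

lemma return_times:
  assumes U: "openin k U" "U \<noteq> {}" and W: "openin k W" "W \<noteq> {}"
  obtains N where "\<And>m. \<exists>\<epsilon>>0. \<forall>j\<ge>2 * N. u m j < \<epsilon> \<longrightarrow> j - N \<in> return_set B U W"
proof -
  obtain x N1 where x: "x \<in> U" "\<And>j. N1 \<le> j \<Longrightarrow> coord x j = 0"
    using finite_vectors_dense[OF U] by metis
  obtain y N2 where y: "y \<in> W" "\<And>j. N2 \<le> j \<Longrightarrow> coord y j = 0"
    using finite_vectors_dense[OF W] by metis
  define N where "N = Suc (max N1 N2)"
  have xE: "x \<in> E" using openin_subset[OF U(1)] x by auto
  \<comment> \<open>With \<open>f\<^sub>j\<close> for \<open>z\<close>, the sum is \<open>y\<close> moved up by \<open>j - N\<close> coordinates.\<close>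
  define P where "P = (\<lambda>z i. x i + (\<Sum>s\<le>N. coord y s * (B ^^ (N - s)) z i))"
  have cP: "continuous_map k k P"
    unfolding P_def
    by (intro continuous_map_k_add continuous_map_k_sum continuous_map_k_scale continuous_map_B_iterate)
       (use xE in auto)
  have coord_sum: "coord (\<lambda>i. \<Sum>s\<in>A. f s i) j = (\<Sum>s\<in>A. coord (f s) j)" for f :: "nat \<Rightarrow> nat \<Rightarrow> 'a" and A j
    by (simp add: coord_def sum_distrib_left)
  have coord_P: "coord (P z) l = coord x l + (\<Sum>s\<le>N. coord y s * coord z (l + (N - s)))" for z l
    by (simp add: P_def coord_sum coord_shift_iterate)
  have "coord (P (\<lambda>i. 0)) = coord x" by (simp add: fun_eq_iff coord_P)
  then have P0: "P (\<lambda>i. 0) = x" by (simp add: coord_inject)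
  have "\<exists>\<epsilon>>0. \<forall>j\<ge>2 * N. u m j < \<epsilon> \<longrightarrow> j - N \<in> return_set B U W" for m
  proof -
    obtain \<epsilon> where e: "\<epsilon> > 0" "\<And>z. z \<in> step m \<Longrightarrow> nrm m z < \<epsilon> \<Longrightarrow> P z \<in> U"
      using step_nhd[OF U(1) cP, of m] P0 x(1) by metis
    have "j - N \<in> return_set B U W" if j: "2 * N \<le> j" "u m j < \<epsilon>" for j
    proof -
      let ?z = "frame (\<lambda>i. if i = j then 1 else 0)"
      have z: "?z \<in> step m" "nrm m ?z \<le> (\<Sum>i<Suc j. u m i * norm (if i = j then 1 else (0::'a)))"
        by (rule frame_finite[of "Suc j"]; simp)+
      have "(\<Sum>i<Suc j. u m i * norm (if i = j then 1 else (0::'a))) = u m j"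
        by (simp add: if_distrib cong: if_cong)
      then have PU: "P ?z \<in> U" using z j by (intro e(2)) auto
      define n where "n = j - N"
      have n: "N \<le> n" "j = n + N" using j by (auto simp: n_def)
      have "coord ((B ^^ n) (P ?z)) l = coord y l" for l
      proof -
        have "(\<Sum>s\<le>N. coord y s * coord ?z (l + n + (N - s))) = (\<Sum>s\<le>N. if s = l then coord y s else 0)"
          by (rule sum.cong) (use n in auto)
        also have "\<dots> = coord y l"
          using y(2)[of l] by (auto simp: N_def)
        finally show ?thesis using x(2)[of "l + n"] n by (simp add: coord_shift_iterate coord_P N_def)
      qed
      then have "(B ^^ n) (P ?z) = y" using coord_inject by blast
      then show ?thesis
        using PU y(1) n(1) unfolding return_set_def n_def[symmetric] by (auto simp: N_def)
    qed
    then show ?thesis using e(1) by blast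
  qed
  then show thesis by (rule that)
qed

lemma bounded_below_or_small:
  assumes "\<not> (\<exists>m. \<forall>\<epsilon>>0. \<forall>n. \<exists>j\<in>I. n \<le> j \<and> u m j < \<epsilon>)"
  shows "\<exists>c>0. \<forall>j\<in>I. c \<le> u m j"
proof -
  obtain \<epsilon> n where e: "\<epsilon> > 0" "\<And>j. j \<in> I \<Longrightarrow> n \<le> j \<Longrightarrow> \<epsilon> \<le> u m j"
    using assms by (meson not_le)
  let ?c = "Min (insert \<epsilon> (u m ` {..<n}))"
  have "?c > 0" using e(1) by simp
  moreover have "?c \<le> u m j" if "j \<in> I" for j
  proof (cases "j < n")
    case True
    then show ?thesis by (intro Min_le) auto
  next
    case False
    have "?c \<le> \<epsilon>" by (intro Min_le) auto
    also have "\<epsilon> \<le> u m j" using e(2) that False by simp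
    finally show ?thesis .
  qed
  ultimately show ?thesis by blast
qed

lemma transitive_iff: "transitive k B \<longleftrightarrow> (\<exists>m. \<forall>\<epsilon>>0. \<forall>n. \<exists>j. n \<le> j \<and> u m j < \<epsilon>)"
proof
  assume t: "transitive k B"
  show "\<exists>m. \<forall>\<epsilon>>0. \<forall>n. \<exists>j. n \<le> j \<and> u m j < \<epsilon>"
  proof (rule ccontr)
    assume "\<not> ?thesis"
    then have "\<not> (\<exists>m. \<forall>\<epsilon>>0. \<forall>n. \<exists>j\<in>{1..}. n \<le> j \<and> u m j < \<epsilon>)" by meson
    then have below: "\<And>m. \<exists>c>0. \<forall>j\<in>{1..}. c \<le> u m j" by (rule bounded_below_or_small)
    have "{1..} \<noteq> ({} :: nat set)" by auto
    from no_return[OF this below] obtain U W where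
      UW: "openin k U" "U \<noteq> {}" "openin k W" "W \<noteq> {}" "{1..} \<inter> return_set B U W = {}" by blast
    moreover have "return_set B U W \<subseteq> {1..}" by (auto simp: return_set_def)
    ultimately have "return_set B U W = {}" by blast
    with t UW show False unfolding transitive_def by blast
  qed
next
  assume "\<exists>m. \<forall>\<epsilon>>0. \<forall>n. \<exists>j. n \<le> j \<and> u m j < \<epsilon>"
  then obtain m where m: "\<And>\<epsilon> n. \<epsilon> > 0 \<Longrightarrow> \<exists>j. n \<le> j \<and> u m j < \<epsilon>" by blast
  show "transitive k B"
    unfolding transitive_def
  proof (intro allI impI)
    fix U W assume "openin k U \<and> U \<noteq> {} \<and> openin k W \<and> W \<noteq> {}"
    then obtain N where N: "\<And>m. \<exists>\<epsilon>>0. \<forall>j\<ge>2 * N. u m j < \<epsilon> \<longrightarrow> j - N \<in> return_set B U W"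
      using return_times by metis
    then obtain \<epsilon> where "\<epsilon> > 0" "\<forall>j\<ge>2 * N. u m j < \<epsilon> \<longrightarrow> j - N \<in> return_set B U W" by blast
    with m[of \<epsilon> "2 * N"] show "return_set B U W \<noteq> {}" by blast
  qed
qed

lemma mixing_iff:
  "mixing k B \<longleftrightarrow> (\<forall>I\<subseteq>{1..}. infinite I \<longrightarrow> (\<exists>m. \<forall>\<epsilon>>0. \<forall>n. \<exists>j\<in>I. n \<le> j \<and> u m j < \<epsilon>))"
proof
  assume mix: "mixing k B"
  show "\<forall>I\<subseteq>{1..}. infinite I \<longrightarrow> (\<exists>m. \<forall>\<epsilon>>0. \<forall>n. \<exists>j\<in>I. n \<le> j \<and> u m j < \<epsilon>)"
  proof (intro allI impI, rule ccontr)
    fix I :: "nat set"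
    assume I: "I \<subseteq> {1..}" "infinite I" and "\<not> (\<exists>m. \<forall>\<epsilon>>0. \<forall>n. \<exists>j\<in>I. n \<le> j \<and> u m j < \<epsilon>)"
    then have below: "\<And>m. \<exists>c>0. \<forall>j\<in>I. c \<le> u m j" by (intro bounded_below_or_small)
    have "I \<noteq> {}" using I by auto
    from no_return[OF this below] obtain U W where
      UW: "openin k U" "U \<noteq> {}" "openin k W" "W \<noteq> {}" "I \<inter> return_set B U W = {}" by blast
    then have "finite ({1..} - return_set B U W)" using mix unfolding mixing_def by blast
    moreover have "I \<subseteq> {1..} - return_set B U W" using I UW by blast
    ultimately show False using I(2) finite_subset by blast
  qed
next
  assume R: "\<forall>I\<subseteq>{1..}. infinite I \<longrightarrow> (\<exists>m. \<forall>\<epsilon>>0. \<forall>n. \<exists>j\<in>I. n \<le> j \<and> u m j < \<epsilon>)"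
  show "mixing k B"
    unfolding mixing_def
  proof (intro allI impI, rule ccontr)
    fix U W assume "openin k U \<and> U \<noteq> {} \<and> openin k W \<and> W \<noteq> {}"
    then obtain N where N: "\<And>m. \<exists>\<epsilon>>0. \<forall>j\<ge>2 * N. u m j < \<epsilon> \<longrightarrow> j - N \<in> return_set B U W"
      using return_times by metis
    let ?J = "{1..} - return_set B U W"
    assume "infinite ?J"
    then have "infinite ((\<lambda>n. n + N) ` ?J)" by (simp add: finite_image_iff)
    moreover have "(\<lambda>n. n + N) ` ?J \<subseteq> {1..}" by auto
    ultimately obtain m where
      m: "\<And>\<epsilon> n. \<epsilon> > 0 \<Longrightarrow> \<exists>j\<in>(\<lambda>n. n + N) ` ?J. n \<le> j \<and> u m j < \<epsilon>" using R by metis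
    obtain \<epsilon> where e: "\<epsilon> > 0" "\<And>j. 2 * N \<le> j \<Longrightarrow> u m j < \<epsilon> \<Longrightarrow> j - N \<in> return_set B U W"
      using N by blast
    obtain n where "n \<in> ?J" "2 * N \<le> n + N" "u m (n + N) < \<epsilon>"
      using m[OF e(1), of "2 * N"] by blast
    then show False using e(2)[of "n + N"] by simp
  qed
qed

lemma topologically_ergodicI:
  assumes syn: "\<And>\<epsilon>. \<epsilon> > 0 \<Longrightarrow> syndetic {j. 1 \<le> j \<and> u m j < \<epsilon>}"
  shows "topologically_ergodic k B"
  unfolding topologically_ergodic_def
proof (intro allI impI)
  fix U W assume "openin k U \<and> U \<noteq> {} \<and> openin k W \<and> W \<noteq> {}"
  then obtain N where N: "\<And>m. \<exists>\<epsilon>>0. \<forall>j\<ge>2 * N. u m j < \<epsilon> \<longrightarrow> j - N \<in> return_set B U W"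
    using return_times by metis
  then obtain \<epsilon> where e: "\<epsilon> > 0" "\<And>j. 2 * N \<le> j \<Longrightarrow> u m j < \<epsilon> \<Longrightarrow> j - N \<in> return_set B U W" by blast
  obtain q where q: "q \<ge> 1" "\<And>n. n \<ge> 1 \<Longrightarrow> {n..n + q} \<inter> {j. 1 \<le> j \<and> u m j < \<epsilon>} \<noteq> {}"
    using syn[OF e(1)] unfolding syndetic_def by blast
  have "{n..n + (q + N)} \<inter> return_set B U W \<noteq> {}" if "n \<ge> 1" for n
  proof -
    have "{n + 2 * N..n + 2 * N + q} \<inter> {j. 1 \<le> j \<and> u m j < \<epsilon>} \<noteq> {}"
      using q(2) \<open>n \<ge> 1\<close> by simp
    then obtain j where "j \<in> {n + 2 * N..n + 2 * N + q}" "u m j < \<epsilon>" by blast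
    then have "j - N \<in> {n..n + (q + N)}" "j - N \<in> return_set B U W" using e(2)[of j] by auto
    then show ?thesis by blast
  qed
  then show "syndetic (return_set B U W)"
    unfolding syndetic_def using q(1) by (intro exI[of _ "q + N"]) auto
qed


section \<open>Periodic points and chaos\<close>

lemma periodic_imp_lp:
  assumes x: "x \<in> periodic_points k B" "x \<noteq> (\<lambda>j. 0)"
  shows "\<exists>m. (\<lambda>j. u m j) \<in> lp_space p"
proof -
  obtain N where xE: "x \<in> E" and N: "1 \<le> N" "(B ^^ N) x = x"
    using x(1) by (auto simp: periodic_points_def)
  have "\<forall>i. \<exists>m. (B ^^ i) x \<in> step m" using B_iterate_in_E[OF xE] by (metis E_cases)
  then obtain f where f: "\<And>i. (B ^^ i) x \<in> step (f i)" by metis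
  \<comment> \<open>Any upper bound of the \<open>f i\<close> will do: the iterates \<open>x, \<dots>, B\<^sup>N\<^sup>-\<^sup>1 x\<close> lie in one common step.\<close>
  define m where "m = (\<Sum>i<N. f i)"
  have "(\<lambda>j. u m j *\<^sub>R coord x (j + i)) \<in> lp_space p" if "i < N" for i
  proof -
    have "f i \<le> m" unfolding m_def using that by (intro member_le_sum) auto
    then have "(B ^^ i) x \<in> step m" using step_mono(1)[OF f] by blast
    then show ?thesis by (simp add: step_coord coord_shift_iterate)
  qed
  then have "(\<lambda>j. \<Sum>i<M. u m j * norm (coord x (j + i))) \<in> lp_space p" if "M \<le> N" for M
    using that
  proof (induction M)
    case 0
    then show ?case by (simp add: lp_space_zero)
  next
    case (Suc M)
    have "(\<lambda>j. u m j * norm (coord x (j + M))) \<in> lp_space p"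
      using lp_cong_norm(1)[where x = "\<lambda>j. u m j * norm (coord x (j + M))" and y = "\<lambda>j. u m j *\<^sub>R coord x (j + M)"] Suc
      by (simp add: abs_mult)
    with Suc show ?case using lp_space_add_norm[OF _ _ p] by fastforce
  qed
  then have sum: "(\<lambda>j. \<Sum>i<N. u m j * norm (coord x (j + i))) \<in> lp_space p" by blast
  have "coord x \<noteq> coord (\<lambda>j. 0)" using x(2) coord_inject by blast
  then obtain r where r: "coord x r \<noteq> 0" by (auto simp: fun_eq_iff)
  have per: "coord x (j + N) = coord x j" for j using N(2) coord_shift_iterate[of N x j] by simp
  have "coord x (j + s * N) = coord x j" for j s
  proof (induction s)
    case (Suc s)
    then show ?case using per[of "j + s * N"] by (simp add: ac_simps)
  qed simp
  then have mod: "coord x j = coord x (j mod N)" for j by (metis mod_div_mult_eq)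
  have le: "u m j \<le> (1 / norm (coord x r)) * (\<Sum>i<N. u m j * norm (coord x (j + i)))" for j
  proof -
    \<comment> \<open>The representative of \<open>r - j\<close> modulo \<open>N\<close>, written without subtraction of \<open>j\<close>.\<close>
    let ?i = "(r + j * (N - 1)) mod N"
    have "(j + ?i) mod N = (j + (r + j * (N - 1))) mod N" by (simp add: mod_add_right_eq)
    also have "j + (r + j * (N - 1)) = r + j * N" using N(1) by (cases N) auto
    finally have "coord x (j + ?i) = coord x r" using mod[of "j + ?i"] mod[of r] by simp
    moreover have "u m j * norm (coord x (j + ?i)) \<le> (\<Sum>i<N. u m j * norm (coord x (j + i)))"
      using N(1) by (intro member_le_sum) (auto simp: less_imp_le)
    ultimately show ?thesis using r by (simp add: field_simps)
  qed
  have "(\<lambda>j. u m j) \<in> lp_space p"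
  proof (rule lp_space_dominated(1)[OF lp_space_scale[OF sum, of "1 / norm (coord x r)"] _ p])
    fix j
    show "norm (u m j) \<le> norm ((1 / norm (coord x r)) * (\<Sum>i<N. u m j * norm (coord x (j + i))))"
      using le[of j] u_pos[of m j] by (simp only: real_norm_def)
  qed
  then show ?thesis by blast
qed

lemma lp_imp_chaotic:
  assumes lp: "(\<lambda>j. u m j) \<in> lp_space p"
  shows "chaotic k B"
  unfolding chaotic_def
proof
  have "(\<lambda>n. lp_norm p (\<lambda>j. if n \<le> j then u m j else 0)) \<longlonglongrightarrow> 0" by (rule lp_tail(2)[OF lp p])
  then have "u m \<longlonglongrightarrow> 0"
  proof (rule Lim_null_comparison[rotated], intro always_eventually allI)
    fix n show "norm (u m n) \<le> lp_norm p (\<lambda>j. if n \<le> j then u m j else 0)"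
      using norm_le_lp_norm[OF lp_tail(1)[OF lp p] p, of n n] by simp
  qed
  then have "\<exists>j. n \<le> j \<and> u m j < \<epsilon>" if "\<epsilon> > 0" for \<epsilon> n
    using order_tendstoD(2)[of "u m" 0 sequentially \<epsilon>] that
    by (metis eventually_sequentially nle_le)
  then show "transitive k B" using transitive_iff by blast
  show "dense_in k (periodic_points k B)"
    unfolding dense_in_def dense_intersects_open
  proof (intro allI impI)
    fix U assume U: "openin k U \<and> U \<noteq> {}"
    then obtain x N where x: "x \<in> U" "\<And>j. N \<le> j \<Longrightarrow> coord x j = 0" using finite_vectors_dense by metis
    obtain \<epsilon> where e: "\<epsilon> > 0" "\<And>z. z \<in> step m \<Longrightarrow> nrm m z < \<epsilon> \<Longrightarrow> (\<lambda>i. x i + z i) \<in> U"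
      using step_nhd_add U x(1) by meson
    define C where "C = (\<Sum>j<N. norm (coord x j))"
    have C: "norm (coord x j) \<le> C" for j
    proof (cases "j < N")
      case True
      then show ?thesis unfolding C_def by (intro member_le_sum) auto
    qed (simp add: x(2) C_def sum_nonneg)
    have C0: "0 \<le> C" by (simp add: C_def sum_nonneg)
    have "\<forall>\<^sub>F n in sequentially. lp_norm p (\<lambda>j. if n \<le> j then C * u m j else 0) < \<epsilon>"
      using order_tendstoD(2)[OF lp_tail(2)[OF lp_space_scale[OF lp] p] e(1)] .
    then obtain n where n: "\<And>M. n \<le> M \<Longrightarrow> lp_norm p (\<lambda>j. if M \<le> j then C * u m j else 0) < \<epsilon>"
      by (auto simp: eventually_sequentially)
    define M where "M = Suc (n + N)"
    have "M \<ge> 1" by (simp add: M_def)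
    \<comment> \<open>The periodization of \<open>x\<close> is \<open>x + z\<close>, and \<open>z\<close> vanishes in the first \<open>M\<close> coordinates.\<close>
    define z where "z = frame (\<lambda>j. coord x (j mod M) - coord x j)"
    have le: "norm (u m j *\<^sub>R coord z j) \<le> norm (if M \<le> j then C * u m j else 0)" for j
      using C[of "j mod M"] C0 x(2)[of j] by (simp add: z_def M_def mult.commute less_imp_le)
    have "z \<in> step m" "nrm m z < \<epsilon>"
      using lp_space_dominated[OF lp_tail(1)[OF lp_space_scale[OF lp] p] le p] n[of M]
      by (auto simp: step_coord nrm_coord M_def)
    then have U': "(\<lambda>i. x i + z i) \<in> U" by (rule e(2))
    have "coord ((B ^^ M) (\<lambda>i. x i + z i)) = coord (\<lambda>i. x i + z i)"
      by (simp add: fun_eq_iff coord_shift_iterate z_def)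
    then have "(B ^^ M) (\<lambda>i. x i + z i) = (\<lambda>i. x i + z i)" by (simp only: coord_inject)
    moreover have "(\<lambda>i. x i + z i) \<in> E" using U' U openin_subset by fastforce
    ultimately have "(\<lambda>i. x i + z i) \<in> periodic_points k B"
      unfolding periodic_points_def using \<open>M \<ge> 1\<close> by auto
    then show "periodic_points k B \<inter> U \<noteq> {}" using U' by blast
  qed
qed

lemma chaotic_imp_periodic:
  assumes "chaotic k B"
  shows "\<exists>x\<in>periodic_points k B. x \<noteq> (\<lambda>j. 0)"
proof -
  let ?W = "{x \<in> E. 0 < norm (coord x 0)}"
  have "frame (\<lambda>j. if j = 0 then 1 else 0) \<in> ?W" using frame_delta_in_E by simp
  then have "?W \<noteq> {}" by blast
  then have "periodic_points k B \<inter> ?W \<noteq> {}"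
    using assms openin_coord_gt[of 0 0] unfolding chaotic_def dense_in_def dense_intersects_open by blast
  then obtain x where "x \<in> periodic_points k B" "coord x 0 \<noteq> 0" by auto
  moreover from this have "x \<noteq> (\<lambda>j. 0)" by (auto simp: coord_def)
  ultimately show ?thesis by blast
qed


section \<open>Hypercyclicity\<close>

lemma sequentially_hypercyclic_imp_hypercyclic:
  assumes "sequentially_hypercyclic k B"
  shows "hypercyclic k B"
proof -
  obtain x where x: "x \<in> E" "sequentially_dense_in k (orbit_of B x)"
    using assms by (auto simp: sequentially_hypercyclic_def)
  have "dense_in k (orbit_of B x)"
    unfolding dense_in_def dense_intersects_open
  proof (intro allI impI)
    fix U assume U: "openin k U \<and> U \<noteq> {}"
    then obtain y where y: "y \<in> U" "y \<in> topspace k" using openin_subset by blast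
    then obtain s where s: "range s \<subseteq> orbit_of B x" "limitin k s y sequentially"
      using x(2) unfolding sequentially_dense_in_def by blast
    then obtain n where "s n \<in> U"
      using U y unfolding limitin_sequentially by blast
    then show "orbit_of B x \<inter> U \<noteq> {}" using s(1) by blast
  qed
  then show ?thesis using x(1) by (auto simp: hypercyclic_def)
qed

lemma hypercyclic_imp_thick:
  assumes "hypercyclic k B"
  shows "\<exists>m. \<exists>I\<subseteq>{1..}. thick I \<and> (u m \<longlongrightarrow> 0) (at_top_in I)"
proof -
  obtain x where x: "x \<in> E" "dense_in k (orbit_of B x)"
    using assms by (auto simp: hypercyclic_def)
  obtain m where m: "x \<in> step m" using x(1) by (rule E_cases)
  have "\<exists>n\<ge>1. \<forall>j\<in>{n..n + q}. real q < norm (coord x j)" for q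
  proof -
    let ?W = "\<Inter>i\<in>{..Suc q}. {y \<in> E. real q < norm (coord y i)}"
    have "openin k ?W" by (intro openin_INT2 ballI openin_coord_gt) auto
    moreover have "frame (\<lambda>j. if j < Suc (Suc q) then of_nat (Suc q) else 0) \<in> ?W"
      using step_subset_E[OF frame_finite(1)[of "Suc (Suc q)"]] by (auto simp del: of_nat_Suc)
    ultimately have "orbit_of B x \<inter> ?W \<noteq> {}"
      using x(2) unfolding dense_in_def dense_intersects_open by blast
    then obtain n where "(B ^^ n) x \<in> ?W" by (auto simp: orbit_of_def)
    then have n: "real q < norm (coord x (i + n))" if "i \<le> Suc q" for i
      using that by (auto simp: coord_shift_iterate)
    \<comment> \<open>The set \<open>?W\<close> controls one coordinate more than needed, so that \<open>n = 0\<close> can be avoided.\<close>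
    show ?thesis
    proof (intro exI[of _ "Suc n"] conjI ballI)
      fix j assume "j \<in> {Suc n..Suc n + q}"
      then show "real q < norm (coord x j)" using n[of "j - n"] by auto
    qed simp
  qed
  then obtain n where n: "\<And>q. 1 \<le> n q" "\<And>q j. j \<in> {n q..n q + q} \<Longrightarrow> real q < norm (coord x j)"
    by metis
  define I where "I = (\<Union>q. {n q..n q + q})"
  have "I \<subseteq> {1..}"
  proof
    fix j assume "j \<in> I"
    then obtain q where "n q \<le> j" by (auto simp: I_def)
    then show "j \<in> {1..}" using n(1)[of q] by simp
  qed
  moreover have "thick I" unfolding thick_def I_def using n(1) by blast
  moreover have "(u m \<longlongrightarrow> 0) (at_top_in I)"
  proof (rule order_tendstoI)
    fix \<epsilon> :: real assume e: "0 < \<epsilon>"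
    obtain Q :: nat where Q: "nrm m x / \<epsilon> < real Q" using reals_Archimedean2 by blast
    have "u m j < \<epsilon>" if j: "j \<in> I" "(\<Sum>q\<le>Q. n q + q) < j" for j
    proof -
      obtain q where q: "j \<in> {n q..n q + q}" using j(1) by (auto simp: I_def)
      have "Q < q"
      proof (rule ccontr)
        assume "\<not> Q < q"
        then have "n q + q \<le> (\<Sum>q\<le>Q. n q + q)" by (intro member_le_sum[of q _ "\<lambda>q. n q + q"]) auto
        then show False using q j(2) by simp
      qed
      have "u m j * real q \<le> u m j * norm (coord x j)"
        using n(2)[OF q] by (intro mult_left_mono) (simp_all add: less_imp_le)
      also have "\<dots> \<le> nrm m x" by (rule coord_le_nrm[OF m])
      also have "\<dots> < \<epsilon> * real Q" using Q e by (simp add: pos_divide_less_eq mult.commute)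
      also have "\<dots> \<le> \<epsilon> * real q" using \<open>Q < q\<close> e by simp
      finally show ?thesis using \<open>Q < q\<close> by simp
    qed
    then show "\<forall>\<^sub>F j in at_top_in I. u m j < \<epsilon>"
      unfolding at_top_in_def eventually_inf_principal eventually_at_top_dense by blast
  next
    fix a :: real assume "a < 0"
    then have "a < u m j" for j using u_pos[of m j] by linarith
    then show "\<forall>\<^sub>F j in at_top_in I. a < u m j" by simp
  qed
  ultimately show ?thesis by blast
qed

text \<open>The \<open>l\<close>-th member \<open>Y l\<close> of a dense sequence of finite vectors is written into the coordinates
  from \<open>n l\<close> on, for \<open>l \<ge> 1\<close>, giving the vector \<open>x\<close>.  Then \<open>B\<^sup>n\<^sup>l\<close> moves the \<open>l\<close>-th block to the origin,
  removes the earlier ones, and leaves the remainder \<open>R l\<close> of the later ones.  The positions are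
  chosen such that \<open>u m\<close> is small on all places that a block takes under the moves which belong to the
  earlier blocks, so that the remainder has norm at most \<open>2\<^sup>-\<^sup>l\<close> in the \<open>m\<close>-th step.\<close>

lemma thick_imp_sequentially_hypercyclic:
  assumes thick: "thick I" and lim: "(u m \<longlongrightarrow> 0) (at_top_in I)"
  shows "sequentially_hypercyclic k B"
proof -
  obtain D :: "'a set" where D: "countable D" "\<And>X. open X \<Longrightarrow> X \<noteq> {} \<Longrightarrow> \<exists>d\<in>D. d \<in> X"
    using countable_dense_exists[where 'a = 'a] by blast
  \<comment> \<open>An enumeration of all finite lists over \<open>D\<close> that hits each of them infinitely often.\<close>
  define d where "d = (\<lambda>l. from_nat_into (lists D) (fst (prod_decode l)))"
  have d: "\<exists>l\<ge>L. d l = xs" if xs: "xs \<in> lists D" for xs L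
  proof -
    obtain a where "from_nat_into (lists D) a = xs"
      using from_nat_into_surj[of "lists D" xs] countable_lists[OF D(1)] xs by blast
    then show ?thesis
      by (intro exI[of _ "prod_encode (a, L)"]) (simp add: d_def le_prod_encode_2)
  qed
  define N where "N l = length (d l)" for l
  define Y where "Y l j = (if j < N l then d l ! j else 0)" for l j
  define \<delta> where "\<delta> l = (1/2) ^ l / (1 + (\<Sum>i<N l. norm (Y l i)))" for l
  have Y0: "0 \<le> (\<Sum>i<N l. norm (Y l i))" for l by (simp add: sum_nonneg)
  have \<delta>: "0 < \<delta> l" "\<delta> l * (\<Sum>i<N l. norm (Y l i)) \<le> (1/2) ^ l" for l
    using Y0[of l] by (auto simp: \<delta>_def field_simps add_pos_nonneg)
  \<comment> \<open>The lower end \<open>b - a\<close> of the interval is the first place of the block \<open>l + 1\<close> after \<open>B\<^sup>a\<close>.\<close>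
  let ?P = "\<lambda>l a. l = 0 \<longrightarrow> a = (0::nat)"
  let ?Q = "\<lambda>l a b. a + N l < b \<and> (\<forall>i\<in>{b - a..<b + N (Suc l)}. u m i < \<delta> (Suc l))"
  have "\<exists>b. ?P (Suc l) b \<and> ?Q l a b" for l a
  proof -
    obtain j where j: "j \<ge> Suc (N l)" "\<And>i. i \<in> {j..j + (a + N (Suc l))} \<Longrightarrow> u m i < \<delta> (Suc l)"
      using at_top_in_thick_block[OF thick lim \<delta>(1)] by blast
    show ?thesis
      by (intro exI[of _ "a + j"]) (use j in auto)
  qed
  then obtain n where n: "\<And>l. ?P l (n l) \<and> ?Q l (n l) (n (Suc l))"
    using dependent_nat_choice[of ?P ?Q] by blast
  have n0: "n 0 = 0" using n[of 0] by simp
  have nN: "n l + N l < n (Suc l)" for l using n[of l] by simp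
  have u_small: "u m i < \<delta> (Suc l)" if "n (Suc l) - n l \<le> i" "i < n (Suc l) + N (Suc l)" for l i
    using n[of l] that by simp
  have "strict_mono n" unfolding strict_mono_Suc_iff by (intro allI le_less_trans[OF le_add1 nN])
  then have n_ge: "l \<le> n l" for l by (rule strict_mono_imp_increasing)
  have n_mono: "n l \<le> n l'" if "l \<le> l'" for l l'
    using \<open>strict_mono n\<close> that by (simp add: strict_mono_less_eq)
  have n_sep: "n l + N l \<le> n l'" if "l < l'" for l l'
    using nN[of l] n_mono[of "Suc l" l'] that by simp
  define g where "g l j = (if n l \<le> j then Y l (j - n l) else 0)" for l j
  have g0: "g l j = 0" if "j < n l \<or> n l + N l \<le> j" for l j
    using that by (auto simp: g_def Y_def)
  \<comment> \<open>The terms with \<open>l' > j + n l\<close> would vanish, since \<open>l' \<le> n l'\<close>.  As \<open>n 0 = 0\<close>, the remainder \<open>R 0\<close>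
      consists of all blocks.\<close>
  define R where "R l j = (\<Sum>l'=Suc l..j + n l. g l' (j + n l))" for l j
  define x where "x = frame (R 0)"

  have block: "(\<Sum>j<J. u m j * norm (g l (j + n l'))) \<le> (1/2) ^ l" if l: "l' < l" for l l' J
  proof -
    define s where "s = n l - n l'"
    have s: "n l = s + n l'" using n_mono[of l' l] l by (simp add: s_def)
    obtain l1 where l1: "l = Suc l1" using l by (cases l) auto
    have "(\<Sum>j<J. u m j * norm (g l (j + n l'))) \<le> (\<Sum>j\<in>{0 + s..<N l + s}. u m j * norm (g l (j + n l')))"
      by (rule sum_le_sum_support) (auto simp: s g0 less_imp_le)
    also have "\<dots> = (\<Sum>i\<in>{0..<N l}. u m (i + s) * norm (g l (i + s + n l')))"
      by (rule sum.shift_bounds_nat_ivl)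
    also have "\<dots> \<le> (\<Sum>i\<in>{0..<N l}. \<delta> l * norm (Y l i))"
    proof (rule sum_mono)
      fix i assume i: "i \<in> {0..<N l}"
      have "n l' \<le> n l1" using n_mono[of l' l1] l l1 by simp
      then have "u m (i + s) < \<delta> l" unfolding l1 using i l1 by (intro u_small) (auto simp: s_def)
      then have "u m (i + s) * norm (Y l i) \<le> \<delta> l * norm (Y l i)" by (intro mult_right_mono) auto
      moreover have "g l (i + s + n l') = Y l i" by (simp add: g_def s)
      ultimately show "u m (i + s) * norm (g l (i + s + n l')) \<le> \<delta> l * norm (Y l i)" by simp
    qed
    also have "\<dots> \<le> (1/2) ^ l" using \<delta>(2)[of l] by (simp add: sum_distrib_left lessThan_atLeast0)
    finally show ?thesis .
  qed
  have "(\<Sum>j<J. u m j * norm (R l j)) \<le> (1/2) ^ l" for l J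
  proof -
    have "norm (R l j) \<le> (\<Sum>l'=Suc l..J + n l. norm (g l' (j + n l)))" if "j < J" for j
    proof -
      have "norm (R l j) \<le> (\<Sum>l'=Suc l..j + n l. norm (g l' (j + n l)))"
        unfolding R_def by (rule norm_sum)
      also have "\<dots> \<le> (\<Sum>l'=Suc l..J + n l. norm (g l' (j + n l)))"
        by (rule sum_mono2) (use that in auto)
      finally show ?thesis .
    qed
    then have "(\<Sum>j<J. u m j * norm (R l j)) \<le> (\<Sum>j<J. u m j * (\<Sum>l'=Suc l..J + n l. norm (g l' (j + n l))))"
      by (intro sum_mono mult_left_mono) (auto simp: less_imp_le)
    also have "\<dots> = (\<Sum>l'=Suc l..J + n l. \<Sum>j<J. u m j * norm (g l' (j + n l)))"
      unfolding sum_distrib_left by (rule sum.swap)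
    also have "\<dots> \<le> (\<Sum>l'=Suc l..J + n l. (1/2) ^ l')"
      by (intro sum_mono block) auto
    also have "\<dots> \<le> (1/2) ^ l" by (rule sum_half_powers_le)
    finally show ?thesis .
  qed
  then have R: "frame (R l) \<in> step m" "nrm m (frame (R l)) \<le> (1/2) ^ l" for l
    using frame_l1 by blast+
  have xE: "x \<in> E" unfolding x_def using R(1) by (rule step_subset_E)

  have "coord ((B ^^ n l) x) j = Y l j + R l j" if "1 \<le> l" for l j
  proof -
    let ?J = "j + n l"
    have "l \<le> ?J" using n_ge[of l] by simp
    then have "{Suc 0..?J} = insert l {1..<l} \<union> {Suc l..?J}" using that by auto
    then have "(\<Sum>l'=Suc 0..?J. g l' ?J) = g l ?J + (\<Sum>l'\<in>{1..<l}. g l' ?J) + (\<Sum>l'=Suc l..?J. g l' ?J)"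
      by (simp only:) (subst sum.union_disjoint; force)
    moreover have "g l' ?J = 0" if "l' < l" for l' using n_sep[OF that] by (intro g0) auto
    moreover have "g l ?J = Y l j" by (simp add: g_def)
    ultimately show ?thesis by (simp add: coord_shift_iterate x_def R_def n0)
  qed
  then have "coord ((B ^^ n l) x) = coord (\<lambda>i. frame (Y l) i + frame (R l) i)" if "1 \<le> l" for l
    using that by (simp add: fun_eq_iff)
  then have orbit: "(B ^^ n l) x = (\<lambda>i. frame (Y l) i + frame (R l) i)" if "1 \<le> l" for l
    using that by (simp only: coord_inject)

  have approx: "\<exists>l\<ge>L. (\<lambda>i. frame (Y l) i - y i) \<in> step m' \<and> nrm m' (\<lambda>i. frame (Y l) i - y i) < \<epsilon>"
    if y: "y \<in> step m'" and e: "\<epsilon> > 0" for y m' \<epsilon> L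
  proof -
    have y': "(\<lambda>i. - y i) \<in> step m'" by (rule step_uminus[OF y])
    let ?tail = "\<lambda>t. frame (\<lambda>j. if t \<le> j then coord (\<lambda>i. - y i) j else 0)"
    have "\<forall>\<^sub>F t in sequentially. nrm m' (?tail t) < \<epsilon> / 2"
      by (rule order_tendstoD(2)[OF nrm_tail_tendsto(2)[OF y']]) (use e in simp)
    then obtain t where t: "nrm m' (?tail t) < \<epsilon> / 2" by (auto simp: eventually_sequentially)
    define \<eta> where "\<eta> = \<epsilon> / (2 * (1 + real t))"
    have \<eta>: "0 < \<eta>" "real t * \<eta> \<le> \<epsilon> / 2" using e by (simp_all add: \<eta>_def field_simps)
    have "\<exists>h\<in>D. h \<in> ball (coord y i) (\<eta> / u m' i)" for i
    proof (rule D(2))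
      have "0 < \<eta> / u m' i" using \<eta>(1) u_pos by (rule divide_pos_pos)
      then show "ball (coord y i) (\<eta> / u m' i) \<noteq> {}" by (simp only: ball_eq_empty not_le)
    qed simp
    then obtain h where h: "\<And>i. h i \<in> D" "\<And>i. h i \<in> ball (coord y i) (\<eta> / u m' i)"
      by metis
    have "map h [0..<t] \<in> lists D" using h(1) by auto
    then obtain l where l: "l \<ge> L" "d l = map h [0..<t]" using d by blast
    let ?head = "\<lambda>j. if j < t then h j - coord y j else 0"
    have hd: "frame ?head \<in> step m'" "nrm m' (frame ?head) \<le> (\<Sum>j<t. u m' j * norm (?head j))"
      by (rule frame_finite[of t]; simp)+
    have "(\<Sum>j<t. u m' j * norm (?head j)) \<le> (\<Sum>j<t. \<eta>)"
    proof (rule sum_mono)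
      fix j assume j: "j \<in> {..<t}"
      have "norm (h j - coord y j) < \<eta> / u m' j"
        using h(2)[of j] by (simp add: dist_norm norm_minus_commute)
      then show "u m' j * norm (?head j) \<le> \<eta>"
        using j by (simp add: pos_less_divide_eq mult.commute less_imp_le)
    qed
    also have "\<dots> \<le> \<epsilon> / 2" using \<eta>(2) by simp
    finally have hd_small: "nrm m' (frame ?head) \<le> \<epsilon> / 2" using hd(2) by simp
    have "coord (\<lambda>i. frame (Y l) i - y i) = coord (\<lambda>i. frame ?head i + ?tail t i)"
      by (simp add: fun_eq_iff Y_def N_def l)
    then have eq: "(\<lambda>i. frame (Y l) i - y i) = (\<lambda>i. frame ?head i + ?tail t i)"
      by (simp only: coord_inject)
    have "(\<lambda>i. frame ?head i + ?tail t i) \<in> step m' \<and> nrm m' (\<lambda>i. frame ?head i + ?tail t i) < \<epsilon>"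
      using step_add[OF hd(1) nrm_tail_tendsto(1)[OF y', of t]] hd_small t by linarith
    then show ?thesis using l(1) unfolding eq[symmetric] by blast
  qed

  have "\<exists>s. range s \<subseteq> orbit_of B x \<and> limitin k s y sequentially" if yE: "y \<in> E" for y
  proof -
    obtain m1 where "y \<in> step m1" using yE by (rule E_cases)
    define m' where "m' = max m m1"
    have y: "y \<in> step m'" by (rule step_mono(1)[OF \<open>y \<in> step m1\<close>]) (simp add: m'_def)
    have "\<exists>l\<ge>Suc s. (\<lambda>i. frame (Y l) i - y i) \<in> step m' \<and> nrm m' (\<lambda>i. frame (Y l) i - y i) < 1 / real (Suc s)" for s
      by (rule approx[OF y]) simp
    then obtain f where f: "\<And>s. Suc s \<le> f s" "\<And>s. (\<lambda>i. frame (Y (f s)) i - y i) \<in> step m'"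
      "\<And>s. nrm m' (\<lambda>i. frame (Y (f s)) i - y i) < 1 / real (Suc s)" by metis
    define z where "z s = (\<lambda>i. (frame (Y (f s)) i - y i) + frame (R (f s)) i)" for s
    have z: "z s \<in> step m'" "nrm m' (z s) \<le> 1 / real (Suc s) + (1/2) ^ s" for s
    proof -
      have R': "frame (R (f s)) \<in> step m'" "nrm m' (frame (R (f s))) \<le> nrm m (frame (R (f s)))"
        using step_mono[OF R(1), of m'] by (simp_all add: m'_def)
      have "(1/2) ^ f s \<le> (1/2 :: real) ^ s" using f(1)[of s] by (intro power_decreasing) auto
      moreover have "nrm m' (z s) \<le> nrm m' (\<lambda>i. frame (Y (f s)) i - y i) + nrm m' (frame (R (f s)))"
        unfolding z_def by (rule step_add(2)[OF f(2) R'(1)])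
      ultimately show "nrm m' (z s) \<le> 1 / real (Suc s) + (1/2) ^ s"
        using R'(2) R(2)[of "f s"] f(3)[of s] by linarith
      show "z s \<in> step m'" unfolding z_def by (rule step_add(1)[OF f(2) R'(1)])
    qed
    have "(\<lambda>s. 1 / real (Suc s) + (1/2) ^ s) \<longlonglongrightarrow> 0 + 0"
      by (intro tendsto_add LIMSEQ_power_zero lim_1_over_n[THEN LIMSEQ_Suc]) auto
    then have "(\<lambda>s. nrm m' (z s)) \<longlonglongrightarrow> 0"
      by (intro tendsto_sandwich[OF _ _ tendsto_const, of 0 "\<lambda>s. nrm m' (z s)"] always_eventually allI)
         (use z(2) in \<open>auto simp: nrm_def lp_norm_nonneg\<close>)
    from limitin_step[OF yE z(1) this] have "limitin k (\<lambda>s i. y i + z s i) y sequentially" .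
    moreover have "(\<lambda>i. y i + z s i) = (B ^^ n (f s)) x" for s
      using orbit[of "f s"] f(1)[of s] by (simp add: z_def)
    ultimately show ?thesis
      by (intro exI[of _ "\<lambda>s. (B ^^ n (f s)) x"]) (auto simp: orbit_of_def)
  qed
  then show ?thesis
    unfolding sequentially_hypercyclic_def sequentially_dense_in_def using xE by auto
qed

end


section \<open>The characterizations\<close>

theorem corollary3p7:
  fixes \<psi> :: "nat \<Rightarrow> nat"
    and w :: "nat \<Rightarrow> 'a::{real_normed_field, euclidean_space}"
    and V :: "nat \<Rightarrow> nat \<Rightarrow> real"
    and p :: real
  defines "B \<equiv> weighted_shift w \<psi>"
    and "k \<equiv> (coechelon_topology p V :: (nat \<Rightarrow> 'a) topology)"
    and "u \<equiv> u_quot w \<psi> V"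
  assumes "is_symbol \<psi>"
    and "weight_sequence w"
    and "decreasing_positive_weights V"
    and "p = 0 \<or> 1 \<le> p"
    and "continuous_linear_operator k B"
  shows
    "(transitive k B \<longleftrightarrow> (\<exists>m. liminf (\<lambda>j. ereal (u m j)) = 0))
     \<and> ((hypercyclic k B \<longleftrightarrow> sequentially_hypercyclic k B)
        \<and> (sequentially_hypercyclic k B \<longleftrightarrow>
             (\<exists>m. \<exists>I\<subseteq>{1..}. thick I \<and> (u m \<longlongrightarrow> 0) (at_top_in I))))
     \<and> (mixing k B \<longleftrightarrow>
          (\<forall>I\<subseteq>{1..}. infinite I \<longrightarrow> (\<exists>m. Liminf (at_top_in I) (\<lambda>j. ereal (u m j)) = 0)))
     \<and> ((\<exists>m. \<forall>\<epsilon>>0. syndetic {j. 1 \<le> j \<and> u m j < \<epsilon>}) \<longrightarrow> topologically_ergodic k B)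
     \<and> (((\<exists>x\<in>periodic_points k B. x \<noteq> (\<lambda>j. 0)) \<longleftrightarrow> (\<exists>m. (\<lambda>j. u m (Suc j)) \<in> lp_space p))
        \<and> ((\<exists>m. (\<lambda>j. u m (Suc j)) \<in> lp_space p) \<longleftrightarrow> chaotic k B))"
proof -
  interpret shift: coechelon_shift \<psi> w V p
    using assms(4-8) unfolding B_def k_def by unfold_locales
  have Lim: "Liminf (at_top_in I) (\<lambda>j. ereal (u m j)) = 0 \<longleftrightarrow> (\<forall>\<epsilon>>0. \<forall>n. \<exists>j\<in>I. n \<le> j \<and> u m j < \<epsilon>)" for I m
    unfolding u_def by (rule Liminf_at_top_in_eq_0_iff) (rule shift.u_pos)
  have "at_top_in UNIV = at_top" by (simp add: at_top_in_def)
  then have liminf: "liminf (\<lambda>j. ereal (u m j)) = 0 \<longleftrightarrow> (\<forall>\<epsilon>>0. \<forall>n. \<exists>j. n \<le> j \<and> u m j < \<epsilon>)" for m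
    using Lim[of UNIV m] by simp
  have a: "transitive k B \<longleftrightarrow> (\<exists>m. liminf (\<lambda>j. ereal (u m j)) = 0)"
    unfolding liminf unfolding B_def k_def u_def by (rule shift.transitive_iff)
  have b: "(\<exists>m. \<exists>I\<subseteq>{1..}. thick I \<and> (u m \<longlongrightarrow> 0) (at_top_in I)) \<Longrightarrow> sequentially_hypercyclic k B"
    "sequentially_hypercyclic k B \<Longrightarrow> hypercyclic k B"
    "hypercyclic k B \<Longrightarrow> \<exists>m. \<exists>I\<subseteq>{1..}. thick I \<and> (u m \<longlongrightarrow> 0) (at_top_in I)"
    unfolding B_def k_def u_def
    using shift.thick_imp_sequentially_hypercyclic shift.sequentially_hypercyclic_imp_hypercyclic
      shift.hypercyclic_imp_thick by blast+
  have c: "mixing k B \<longleftrightarrow>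
      (\<forall>I\<subseteq>{1..}. infinite I \<longrightarrow> (\<exists>m. Liminf (at_top_in I) (\<lambda>j. ereal (u m j)) = 0))"
    unfolding Lim unfolding B_def k_def u_def by (rule shift.mixing_iff)
  have d: "(\<exists>m. \<forall>\<epsilon>>0. syndetic {j. 1 \<le> j \<and> u m j < \<epsilon>}) \<longrightarrow> topologically_ergodic k B"
    unfolding B_def k_def u_def using shift.topologically_ergodicI by blast
  have lp: "(\<lambda>j. u m (Suc j)) \<in> lp_space p \<longleftrightarrow> (\<lambda>j. u m j) \<in> lp_space p" for m
    by (rule lp_space_Suc)
  have e: "(\<exists>x\<in>periodic_points k B. x \<noteq> (\<lambda>j. 0)) \<Longrightarrow> \<exists>m. (\<lambda>j. u m (Suc j)) \<in> lp_space p"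
    "\<exists>m. (\<lambda>j. u m (Suc j)) \<in> lp_space p \<Longrightarrow> chaotic k B"
    "chaotic k B \<Longrightarrow> \<exists>x\<in>periodic_points k B. x \<noteq> (\<lambda>j. 0)"
    unfolding lp unfolding B_def k_def u_def
    using shift.periodic_imp_lp shift.lp_imp_chaotic shift.chaotic_imp_periodic by blast+
  show ?thesis using a b c d e by blast
qed

end
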